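(* Let $\mathfrak{J}:\mathcal{S}\to\mathbb{R}_{\ge 0}$ be a set function satisfying the standing assumptions given in the context, and assume $\dim_\infty(\mathfrak{J})>0$. If $\mathfrak{J}$ is PF-regular, then it is MF-regular. If $\mathfrak{J}$ is MF-regular, then the $\mathfrak{J}$-partition entropy $h$ exists (i.e. $\underline{h}=\overline{h}=:h$) and $$h=\mathfrak{q}=\kappa=F,$$ where $F:=\underline{F}=\overline{F}$.
   Context: Dyadic cubes. Let $d\in\mathbb{N}$. A dyadic cube of side length $2^{-n}$ is a product $I_1\times\cdots\times I_d$ of intervals of length $2^{-n}$ (each half-open, open, or closed) with endpoints in $\{k2^{-n}:k\in\mathbb{Z}\}$. Fix a dyadic unit cube $\mathcal{Q}\subset\mathbb{R}^d$ and partitions $\mathcal{D}_n$ of $\mathcal{Q}$ into dyadic cubes of side length $2^{-n}$ with $\mathcal{D}_0=\{\mathcal{Q}\}$ and such that each element of $\mathcal{D}_n$ is the disjoint union of exactly $2^d$ elements of $\mathcal{D}_{n+1}$. Put $\mathcal{D}=\bigcup_{n\ge0}\mathcal{D}_n$. Fix a subset $\mathcal{S}\subset\mathcal{D}$ and put $\mathcal{S}_n=\mathcal{S}\cap\mathcal{D}_n$. Standing assumptions on $\mathfrak{J}:\mathcal{S}\to\mathbb{R}_{\ge0}$: (1) non-trivial: $\mathfrak{J}\not\equiv0$; (2) monotone: $Q\subset Q'$ in $\mathcal{S}$ implies $\mathfrak{J}(Q)\le\mathfrak{J}(Q')$; (3) uniformly vanishing: $j_n:=\sup\{\mathfrak{J}(Q):Q\in\bigcup_{k\ge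 n}\mathcal{S}_k\}\to0$ as $n\to\infty$; (4) locally non-vanishing: for every $n\ge 0$ and $Q\in\mathcal{S}_n$ with $\mathfrak{J}(Q)>0$ there is $Q'\in\mathcal{S}_{n+1}$ with $Q'\subset Q$ and $\mathfrak{J}(Q')>0$; (5) there exist $a>0$, $b\in\mathbb{R}$ with $\tau_n(a)\ge b$ for all large $n$ ($\tau_n$ defined below). Definitions. For $x>1/j_0$, $$G_x=\{Q\in\mathcal{S}:\mathfrak{J}(Q)<1/x\text{ and, if }Q\in\mathcal{D}_n,\ \exists Q'\in\mathcal{S}_{n-1}\text{ with }Q'\supset Q,\ \mathfrak{J}(Q')\ge1/x\},$$ $M(x)=\operatorname{card}(G_x)$, $\overline{h}=\limsup_{x\to\infty}\frac{\log M(x)}{\log x}$, $\underline{h}=\liminf_{x\to\infty}\frac{\log M(x)}{\log x}$. For $q\ge0$, $\tau_n(q)=\frac{1}{\log 2^n}\log\sum_{Q\in\mathcal{S}_n}\mathfrak{J}(Q)^q$ (with $0^0=0$) and $\tau(q)=\limsup_{n\to\infty}\tau_n(q)$. Further $\mathfrak{q}=\inf\{q\ge0:\tau(q)<0\}$, $\kappa=\inf\{q\ge0:\sum_{Q\in\mathcal{S}}\mathfrak{J}(Q)^q<\infty\}$, and $\dim_\infty(\mathfrak{J})=\liminf_{n\to\infty}\frac{\log\max_{Q\in\mathcal{S}_n}\mathfrak{J}(Q)}{-\log 2^n}$. For $\alpha>0$, $N_\alpha(n)=\operatorname{card}\{Q\in\mathcal{S}_n:\mathfrak{J}(Q)\ge2^{-\alpha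 n}\}$, $\overline{F}(\alpha)=\limsup_{n}\frac{\log^+N_\alpha(n)}{\log2^n}$, $\underline{F}(\alpha)=\liminf_{n}\frac{\log^+N_\alpha(n)}{\log2^n}$ with $\log^+(y)=\max\{0,\log y\}$ ($\log^+0=0$), and $\overline{F}=\sup_{\alpha>0}\overline{F}(\alpha)/\alpha$, $\underline{F}=\sup_{\alpha>0}\underline{F}(\alpha)/\alpha$. Regularity (for $\dim_\infty(\mathfrak{J})>0$). $\mathfrak{J}$ is MF-regular (multifractal-regular) if $\underline{F}=\overline{F}$. $\mathfrak{J}$ is PF-regular (partition function regular) if either (i) for some $\varepsilon>0$, $\tau(q)=\liminf_{n\to\infty}\tau_n(q)$ for all $q\in(\mathfrak{q}-\varepsilon,\mathfrak{q})$ (with $q\geq 0$), or (ii) $\tau(\mathfrak{q})=\liminf_{n\to\infty}\tau_n(\mathfrak{q})$ and $\tau$ is differentiable at $\mathfrak{q}$. *)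

theory Defs
  imports "HOL-Analysis.Analysis"
begin

section \<open>Dyadic cubes and nested dyadic partitions\<close>

definition dyadic_interval :: "nat \<Rightarrow> real set \<Rightarrow> bool" where
  "dyadic_interval n I \<longleftrightarrow>
     (\<exists>k::int. let a = of_int k / 2 ^ n; b = of_int (k + 1) / 2 ^ n
               in I \<in> {{a..b}, {a..<b}, {a<..b}, {a<..<b}})"

definition dyadic_cube :: "nat \<Rightarrow> (real ^ 'd) set \<Rightarrow> bool" where
  "dyadic_cube n Q \<longleftrightarrow>
     (\<exists>I. (\<forall>i. dyadic_interval n (I i)) \<and> Q = {x. \<forall>i. x $ i \<in> I i})"

locale dyadic_partitions =
  fixes Q0 :: "(real ^ 'd) set" and D :: "nat \<Rightarrow> (real ^ 'd) set set"
  assumes unit_cube: "dyadic_cube 0 Q0"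
    and zero: "D 0 = {Q0}"
    and partition: "partition_on Q0 (D n)"
    and cubes: "Q \<in> D n \<Longrightarrow> dyadic_cube n Q"
    and children: "Q \<in> D n \<Longrightarrow>
      \<exists>P \<subseteq> D (Suc n). card P = 2 ^ CARD('d) \<and> disjoint P \<and> \<Union>P = Q"

definition level :: "(nat \<Rightarrow> 'a set set) \<Rightarrow> 'a set set \<Rightarrow> nat \<Rightarrow> 'a set set" where
  "level D S n = S \<inter> D n"


section \<open>Quantities attached to a set function\<close>

text \<open>
  All of the following take the levels \<open>D\<close>, the family \<open>S\<close> and the set function \<open>J\<close> as
  arguments; only the values of \<open>J\<close> on \<open>S\<close> matter. They are extended reals, so that suprema,
  infima and limits superior and inferior exist without side conditions. The normalising
  factor \<open>ln (2 ^ n)\<close> vanishes for \<open>n = 0\<close>; that term does not affect any limit.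
\<close>

definition elog :: "real \<Rightarrow> ereal" where
  "elog y = (if y > 0 then ereal (ln y) else -\<infinity>)"

definition log_plus :: "real \<Rightarrow> real" where
  "log_plus y = (if y > 0 then max 0 (ln y) else 0)"

definition sup_from :: "(nat \<Rightarrow> 'a set set) \<Rightarrow> 'a set set \<Rightarrow> ('a set \<Rightarrow> real) \<Rightarrow> nat \<Rightarrow> ereal" where
  "sup_from D S J n = (SUP Q \<in> (\<Union>k\<in>{n..}. level D S k). ereal (J Q))"

text \<open>A cube of level \<open>0\<close> has no predecessor and hence never belongs to \<open>G\<close>.\<close>

definition G :: "(nat \<Rightarrow> 'a set set) \<Rightarrow> 'a set set \<Rightarrow> ('a set \<Rightarrow> real) \<Rightarrow> real \<Rightarrow> 'a set set" where
  "G D S J x = {Q \<in> S. J Q < 1 / x \<and>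
     (\<exists>n. Q \<in> D (Suc n) \<and> (\<exists>Q' \<in> level D S n. Q \<subseteq> Q' \<and> J Q' \<ge> 1 / x))}"

definition M :: "(nat \<Rightarrow> 'a set set) \<Rightarrow> 'a set set \<Rightarrow> ('a set \<Rightarrow> real) \<Rightarrow> real \<Rightarrow> nat" where
  "M D S J x = card (G D S J x)"

definition h_upper :: "(nat \<Rightarrow> 'a set set) \<Rightarrow> 'a set set \<Rightarrow> ('a set \<Rightarrow> real) \<Rightarrow> ereal" where
  "h_upper D S J = Limsup at_top (\<lambda>x. elog (real (M D S J x)) / ereal (ln x))"

definition h_lower :: "(nat \<Rightarrow> 'a set set) \<Rightarrow> 'a set set \<Rightarrow> ('a set \<Rightarrow> real) \<Rightarrow> ereal" where
  "h_lower D S J = Liminf at_top (\<lambda>x. elog (real (M D S J x)) / ereal (ln x))"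

text \<open>The convention \<open>0\<^sup>0 = 0\<close> is the one of \<open>powr\<close>.\<close>

definition \<tau>_at :: "(nat \<Rightarrow> 'a set set) \<Rightarrow> 'a set set \<Rightarrow> ('a set \<Rightarrow> real) \<Rightarrow> nat \<Rightarrow> real \<Rightarrow> ereal" where
  "\<tau>_at D S J n q = elog (\<Sum>Q\<in>level D S n. J Q powr q) / ereal (ln (2 ^ n))"

definition \<tau>_upper :: "(nat \<Rightarrow> 'a set set) \<Rightarrow> 'a set set \<Rightarrow> ('a set \<Rightarrow> real) \<Rightarrow> real \<Rightarrow> ereal" where
  "\<tau>_upper D S J q = limsup (\<lambda>n. \<tau>_at D S J n q)"

definition \<tau>_lower :: "(nat \<Rightarrow> 'a set set) \<Rightarrow> 'a set set \<Rightarrow> ('a set \<Rightarrow> real) \<Rightarrow> real \<Rightarrow> ereal" where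
  "\<tau>_lower D S J q = liminf (\<lambda>n. \<tau>_at D S J n q)"

definition \<qq> :: "(nat \<Rightarrow> 'a set set) \<Rightarrow> 'a set set \<Rightarrow> ('a set \<Rightarrow> real) \<Rightarrow> ereal" where
  "\<qq> D S J = Inf (ereal ` {q. q \<ge> 0 \<and> \<tau>_upper D S J q < 0})"

definition \<kappa> :: "'a set set \<Rightarrow> ('a set \<Rightarrow> real) \<Rightarrow> ereal" where
  "\<kappa> S J = Inf (ereal ` {q. q \<ge> 0 \<and> (\<lambda>Q. J Q powr q) summable_on S})"

text \<open>
  \<open>Max\<close> is only meaningful for nonempty levels; under the standing assumptions all but finitely
  many levels are nonempty.
\<close>

definition dim_infty :: "(nat \<Rightarrow> 'a set set) \<Rightarrow> 'a set set \<Rightarrow> ('a set \<Rightarrow> real) \<Rightarrow> ereal" where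
  "dim_infty D S J = liminf (\<lambda>n. elog (Max (J ` level D S n)) / ereal (- ln (2 ^ n)))"

definition N :: "(nat \<Rightarrow> 'a set set) \<Rightarrow> 'a set set \<Rightarrow> ('a set \<Rightarrow> real) \<Rightarrow> real \<Rightarrow> nat \<Rightarrow> nat" where
  "N D S J \<alpha> n = card {Q \<in> level D S n. J Q \<ge> 2 powr (- \<alpha> * real n)}"

definition F_upper_at :: "(nat \<Rightarrow> 'a set set) \<Rightarrow> 'a set set \<Rightarrow> ('a set \<Rightarrow> real) \<Rightarrow> real \<Rightarrow> ereal" where
  "F_upper_at D S J \<alpha> = limsup (\<lambda>n. ereal (log_plus (real (N D S J \<alpha> n)) / ln (2 ^ n)))"

definition F_lower_at :: "(nat \<Rightarrow> 'a set set) \<Rightarrow> 'a set set \<Rightarrow> ('a set \<Rightarrow> real) \<Rightarrow> real \<Rightarrow> ereal" where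
  "F_lower_at D S J \<alpha> = liminf (\<lambda>n. ereal (log_plus (real (N D S J \<alpha> n)) / ln (2 ^ n)))"

definition F_upper :: "(nat \<Rightarrow> 'a set set) \<Rightarrow> 'a set set \<Rightarrow> ('a set \<Rightarrow> real) \<Rightarrow> ereal" where
  "F_upper D S J = (SUP \<alpha>\<in>{0<..}. F_upper_at D S J \<alpha> / ereal \<alpha>)"

definition F_lower :: "(nat \<Rightarrow> 'a set set) \<Rightarrow> 'a set set \<Rightarrow> ('a set \<Rightarrow> real) \<Rightarrow> ereal" where
  "F_lower D S J = (SUP \<alpha>\<in>{0<..}. F_lower_at D S J \<alpha> / ereal \<alpha>)"


section \<open>Standing assumptions and regularity\<close>

locale partition_set_function = dyadic_partitions Q0 D
  for Q0 :: "(real ^ 'd) set" and D +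
  fixes S :: "(real ^ 'd) set set" and J :: "(real ^ 'd) set \<Rightarrow> real"
  assumes subset: "S \<subseteq> (\<Union>n. D n)"
    and nonneg: "Q \<in> S \<Longrightarrow> J Q \<ge> 0"
    and nontrivial: "\<exists>Q\<in>S. J Q \<noteq> 0"
    and monotone: "Q \<in> S \<Longrightarrow> Q' \<in> S \<Longrightarrow> Q \<subseteq> Q' \<Longrightarrow> J Q \<le> J Q'"
    and uniformly_vanishing: "sup_from D S J \<longlonglongrightarrow> 0"
    and locally_nonvanishing: "Q \<in> level D S n \<Longrightarrow> J Q > 0 \<Longrightarrow>
      \<exists>Q' \<in> level D S (Suc n). Q' \<subseteq> Q \<and> J Q' > 0"
    and lower_bound: "\<exists>a>0. \<exists>b::real. \<forall>\<^sub>F n in sequentially. \<tau>_at D S J n a \<ge> ereal b"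

definition MF_regular :: "(nat \<Rightarrow> 'a set set) \<Rightarrow> 'a set set \<Rightarrow> ('a set \<Rightarrow> real) \<Rightarrow> bool" where
  "MF_regular D S J \<longleftrightarrow> F_lower D S J = F_upper D S J"

text \<open>
  The domain of \<open>\<tau>_upper\<close> is \<open>{0..}\<close>, so differentiability is relative to this set (for positive
  \<open>\<qq>\<close> this is ordinary differentiability). Finiteness of \<open>\<tau>_upper\<close> near \<open>\<qq>\<close> is part of the
  requirement: \<open>f\<close> is \<open>\<tau>_upper\<close> as a real-valued function.
\<close>

definition PF_regular :: "(nat \<Rightarrow> 'a set set) \<Rightarrow> 'a set set \<Rightarrow> ('a set \<Rightarrow> real) \<Rightarrow> bool" where
  "PF_regular D S J \<longleftrightarrow>
     (\<exists>\<epsilon>>0. \<forall>q\<ge>0. \<qq> D S J - ereal \<epsilon> < ereal q \<and> ereal q < \<qq> D S J \<longrightarrow>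
        \<tau>_upper D S J q = \<tau>_lower D S J q) \<or>
     (\<exists>r. \<qq> D S J = ereal r \<and> \<tau>_upper D S J r = \<tau>_lower D S J r \<and>
        (\<exists>f \<delta>. \<delta> > 0 \<and> (\<forall>q\<in>{0..} \<inter> ball r \<delta>. \<tau>_upper D S J q = ereal (f q)) \<and>
           f differentiable (at r within {0..})))"

end

theory Submission
  imports Defs "HOL-Real_Asymp.Real_Asymp"
begin

text \<open>
  Write \<open>s n q\<close> for the sum of \<open>J Q powr q\<close> over the cubes \<open>Q\<close> of level \<open>n\<close> and \<open>d\<close> for the
  dimension. Positivity of \<open>dim_infty\<close> means that all values on a late level \<open>n\<close> are at most
  \<open>2 powr (- \<delta> n)\<close>, so that \<open>\<tau>_upper\<close> drops at least with slope \<open>\<delta>\<close>. Since a level has at most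
  \<open>2 powr (d n)\<close> cubes, \<open>\<qq>\<close> is finite, \<open>\<tau>_upper\<close> is negative beyond \<open>\<qq>\<close> and positive before
  it, and comparison with geometric series gives \<open>\<qq> = \<kappa>\<close>.

  The second part of the statement is the chain
  \<open>F_lower \<le> h_lower \<le> h_upper \<le> \<qq> = F_upper\<close>, which collapses under \<open>F_lower = F_upper\<close>.
  For \<open>F_lower \<le> h_lower\<close> (\<open>F_lower_le_h_lower\<close>): below each cube of value at least \<open>1 / x\<close>
  there is a cube of \<open>G x\<close>, because values along a chain of positive children tend to zero;
  hence \<open>N \<alpha> n \<le> M x\<close> as soon as \<open>2 powr (\<alpha> n) \<le> x\<close>.
  For \<open>h_upper \<le> \<qq>\<close> (\<open>h_upper_le_\<qq>\<close>): cubes of \<open>G x\<close> have parents of value at least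
  \<open>1 / x\<close>, and by Markov's inequality their number is at most \<open>x powr q\<close> times the sum of all
  \<open>s n q\<close>, which converges if \<open>\<tau>_upper q < 0\<close>. For \<open>F_upper \<le> \<qq>\<close>, Markov's inequality is
  applied on a single level.
  For \<open>\<qq> \<le> F_upper\<close> (\<open>\<qq>_le_F_upper\<close>): the cubes of a level are sorted into finitely many classes
  by the exponential size of their value; if all counting functions were too small, no class
  could make \<open>s n q\<close> grow for \<open>q < \<qq>\<close>.

  The first part needs \<open>\<qq> \<le> F_lower\<close>, that is, one \<open>\<alpha>\<close> that works on all late levels. The
  classes above are not enough, since the dominating class may change with \<open>n\<close>. Where
  \<open>\<tau>_upper\<close> is almost linear near \<open>q\<close>, with slope \<open>- \<sigma>\<close>, an exponential Chebyshev argument shows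
  that \<open>s n q\<close> is carried by cubes of value about \<open>2 powr (- \<sigma> n)\<close>, on all levels on which
  \<open>s n q\<close> has the expected size (\<open>F_lower_at_ge_concentration\<close>). Hence it suffices that the
  limit exists at \<open>q\<close> while its neighbours are bounded by the limit superior. This yields
  \<open>F_lower \<ge> q\<close> up to an error that vanishes with the deviation from linearity
  (\<open>F_lower_ge_almost_linear\<close>). If \<open>\<tau>_upper\<close> is differentiable at \<open>\<qq>\<close>, one takes \<open>q = \<qq>\<close>. If the
  limit exists on an interval to the left of \<open>\<qq>\<close>, suitable points \<open>q\<close> arbitrarily close to \<open>\<qq>\<close>
  exist because \<open>\<tau>_upper\<close> is decreasing and Lipschitz: along an equidistant grid the successive
  differences cannot keep dropping (\<open>exists_small_second_difference\<close>).
\<close>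

section \<open>Counting dyadic cubes\<close>

context dyadic_partitions
begin

lemma cube_nonempty: "Q \<in> D n \<Longrightarrow> Q \<noteq> {}"
  using partition[of n] by (auto simp: partition_on_def)

lemma cube_eqI: "Q \<in> D n \<Longrightarrow> R \<in> D n \<Longrightarrow> x \<in> Q \<Longrightarrow> x \<in> R \<Longrightarrow> Q = R"
  using partition[of n] by (auto simp: partition_on_def disjoint_def)

lemma card_children:
  assumes "Q \<in> D n"
  shows "finite {R \<in> D (Suc n). R \<subseteq> Q} \<and> card {R \<in> D (Suc n). R \<subseteq> Q} \<le> 2 ^ CARD('d)"
proof -
  obtain P where P: "P \<subseteq> D (Suc n)" "card P = 2 ^ CARD('d)" "\<Union>P = Q"
    using children[OF assms] by auto
  have fin: "finite P"
    using P(2) by (intro card_ge_0_finite) simp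
  have "{R \<in> D (Suc n). R \<subseteq> Q} \<subseteq> P"
  proof
    fix R assume R: "R \<in> {R \<in> D (Suc n). R \<subseteq> Q}"
    then obtain x where x: "x \<in> R" using cube_nonempty by blast
    then obtain p where "p \<in> P" "x \<in> p" using R P(3) by auto
    then have "R = p" using R P(1) by (intro cube_eqI[of R "Suc n" p x] x) auto
    with \<open>p \<in> P\<close> show "R \<in> P" by simp
  qed
  then show ?thesis using fin P(2) card_mono[OF fin] finite_subset[OF _ fin] by simp
qed

lemma parent_exists:
  assumes "R \<in> D (Suc n)"
  shows "\<exists>Q\<in>D n. R \<subseteq> Q"
proof -
  obtain x where x: "x \<in> R" using cube_nonempty[OF assms] by blast
  then have "x \<in> Q0" using partition[of "Suc n"] assms by (auto simp: partition_on_def)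
  then obtain Q where Q: "Q \<in> D n" "x \<in> Q" using partition[of n] by (auto simp: partition_on_def)
  obtain P where P: "P \<subseteq> D (Suc n)" "\<Union>P = Q" using children[OF Q(1)] by auto
  then obtain p where "p \<in> P" "x \<in> p" using Q(2) by auto
  then have "R = p" using cube_eqI[OF assms _ x] P(1) by auto
  then show ?thesis using \<open>p \<in> P\<close> P(2) Q(1) by auto
qed

lemma card_level: "finite (D n) \<and> card (D n) \<le> 2 ^ (CARD('d) * n)"
proof (induction n)
  case 0
  then show ?case by (simp add: zero)
next
  case (Suc n)
  let ?C = "\<lambda>Q. {R \<in> D (Suc n). R \<subseteq> Q}"
  have eq: "(\<Union>Q\<in>D n. ?C Q) = D (Suc n)" using parent_exists by auto
  have "card (\<Union>Q\<in>D n. ?C Q) \<le> (\<Sum>Q\<in>D n. card (?C Q))"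
    using Suc by (intro card_UN_le) auto
  also have "\<dots> \<le> (\<Sum>Q\<in>D n. 2 ^ CARD('d))"
    using card_children by (intro sum_mono) auto
  also have "\<dots> \<le> 2 ^ (CARD('d) * n) * 2 ^ CARD('d)"
    using Suc by simp
  finally have "card (D (Suc n)) \<le> 2 ^ (CARD('d) * Suc n)"
    unfolding eq by (simp add: power_add mult.commute)
  moreover have "finite (\<Union>Q\<in>D n. ?C Q)"
    using Suc card_children by (intro finite_UN_I) auto
  then have "finite (D (Suc n))" unfolding eq .
  ultimately show ?case by blast
qed

end


section \<open>Growth exponents\<close>

text \<open>
  The following equivalences turn bounds on the extended-real exponents into bounds on the
  counted quantities themselves; the case of a vanishing quantity, whose logarithm is \<open>-\<infinity>\<close> or
  cut off at \<open>0\<close>, is absorbed here once and for all.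
\<close>

lemma elog_ratio_less_iff:
  assumes "x > 1"
  shows "elog y / ereal (ln x) < ereal c \<longleftrightarrow> y < x powr c"
proof (cases "y > 0")
  case True
  have "ln y / ln x < c \<longleftrightarrow> ln y < c * ln x" using assms by (simp add: pos_divide_less_eq)
  also have "\<dots> \<longleftrightarrow> y < x powr c"
    using assms True ln_less_cancel_iff[of y "x powr c"] by simp
  finally show ?thesis using True assms by (simp add: elog_def)
next
  case False
  moreover have "0 < x powr c" using assms by simp
  ultimately have "y < x powr c" by linarith
  then show ?thesis using False assms by (simp add: elog_def)
qed

lemma elog_ratio_greater_iff:
  assumes "x > 1"
  shows "ereal c < elog y / ereal (ln x) \<longleftrightarrow> x powr c < y"
proof (cases "y > 0")
  case True
  have "c < ln y / ln x \<longleftrightarrow> c * ln x < ln y" using assms by (simp add: pos_less_divide_eq)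
  also have "\<dots> \<longleftrightarrow> x powr c < y"
    using assms True ln_less_cancel_iff[of "x powr c" y] by simp
  finally show ?thesis using True assms by (simp add: elog_def)
next
  case False
  moreover have "0 \<le> x powr c" by simp
  ultimately have "\<not> x powr c < y" by linarith
  then show ?thesis using False assms by (simp add: elog_def)
qed

lemma log_plus_ratio_le_iff:
  assumes "x > 1" "c \<ge> 0"
  shows "log_plus y / ln x \<le> c \<longleftrightarrow> y \<le> x powr c"
proof (cases "y > 0")
  case True
  have "log_plus y / ln x \<le> c \<longleftrightarrow> max 0 (ln y) \<le> c * ln x"
    using assms True by (simp add: pos_divide_le_eq log_plus_def)
  also have "\<dots> \<longleftrightarrow> ln y \<le> c * ln x" using assms by simp
  also have "\<dots> \<longleftrightarrow> y \<le> x powr c"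
    using assms True ln_le_cancel_iff[of y "x powr c"] by simp
  finally show ?thesis .
next
  case False
  moreover have "0 \<le> x powr c" by simp
  ultimately have "y \<le> x powr c" by linarith
  then show ?thesis using False assms by (simp add: log_plus_def)
qed

lemma log_plus_ratio_nonneg: "x \<ge> 1 \<Longrightarrow> 0 \<le> log_plus y / ln x"
  by (simp add: log_plus_def)

lemma two_power_powr: "(2 ^ n) powr c = 2 powr (c * real n)"
  by (simp add: powr_realpow[symmetric] powr_powr mult.commute)

lemma eventually_const_le_powr:
  assumes "e > 0"
  shows "\<forall>\<^sub>F n in sequentially. C \<le> 2 powr (e * real n)"
  using assms by real_asymp

lemma ereal_divide_leI:
  fixes X Y :: ereal and a :: real
  assumes "a > 0" "0 \<le> Y" "\<And>c::real. c > 0 \<Longrightarrow> ereal (c * a) < X \<Longrightarrow> ereal c \<le> Y"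
  shows "X / ereal a \<le> Y"
proof (rule ccontr)
  assume "\<not> ?thesis"
  then have "Y < X / ereal a" by simp
  then obtain c where c: "Y < ereal c" "ereal c < X / ereal a" using ereal_dense2 by blast
  have "c > 0" using assms(2) c(1) by (metis ereal_less(2) order_le_less_trans)
  moreover have "ereal (c * a) < X"
    using c(2) assms(1) by (cases X) (auto simp: field_simps)
  ultimately show False using assms(3) c(1) by (metis not_less)
qed


section \<open>Power sums over one level\<close>

context partition_set_function
begin

abbreviation power_sum :: "nat \<Rightarrow> real \<Rightarrow> real" where
  "power_sum n q \<equiv> (\<Sum>Q\<in>level D S n. J Q powr q)"

lemma finite_level: "finite (level D S n)"
  using card_level[of n] by (auto simp: level_def)

lemma card_level_S: "real (card (level D S n)) \<le> 2 powr (real CARD('d) * real n)"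
proof -
  have "card (level D S n) \<le> card (D n)"
    using card_level[of n] by (intro card_mono) (auto simp: level_def)
  then have "card (level D S n) \<le> 2 ^ (CARD('d) * n)" using card_level[of n] by linarith
  then have "real (card (level D S n)) \<le> real (2 ^ (CARD('d) * n))"
    by (rule of_nat_mono)
  also have "\<dots> = 2 powr real (CARD('d) * n)"
    by (subst powr_realpow) auto
  finally show ?thesis by simp
qed

lemma level_nonneg: "Q \<in> level D S n \<Longrightarrow> J Q \<ge> 0"
  using nonneg by (auto simp: level_def)

lemma power_sum_nonneg: "power_sum n q \<ge> 0"
  by (intro sum_nonneg) simp

lemma \<tau>_at_less_iff: "n > 0 \<Longrightarrow> \<tau>_at D S J n q < ereal c \<longleftrightarrow> power_sum n q < 2 powr (c * real n)"
  unfolding \<tau>_at_def by (subst elog_ratio_less_iff) (auto simp: two_power_powr)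

lemma \<tau>_at_greater_iff: "n > 0 \<Longrightarrow> ereal c < \<tau>_at D S J n q \<longleftrightarrow> 2 powr (c * real n) < power_sum n q"
  unfolding \<tau>_at_def by (subst elog_ratio_greater_iff) (auto simp: two_power_powr)

lemma eventually_power_sum_less:
  assumes "\<tau>_upper D S J q < ereal c"
  shows "\<forall>\<^sub>F n in sequentially. power_sum n q < 2 powr (c * real n)"
  using Limsup_lessD[OF assms[unfolded \<tau>_upper_def]] eventually_gt_at_top[of 0]
  by eventually_elim (simp add: \<tau>_at_less_iff)

lemma eventually_power_sum_greater:
  assumes "ereal c < \<tau>_lower D S J q"
  shows "\<forall>\<^sub>F n in sequentially. 2 powr (c * real n) < power_sum n q"
  using less_LiminfD[OF assms[unfolded \<tau>_lower_def]] eventually_gt_at_top[of 0]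
  by eventually_elim (simp add: \<tau>_at_greater_iff)

lemma \<tau>_upper_leI:
  assumes "\<forall>\<^sub>F n in sequentially. power_sum n q \<le> 2 powr (c * real n)"
  shows "\<tau>_upper D S J q \<le> ereal c"
  unfolding \<tau>_upper_def
proof (rule Limsup_bounded)
  show "\<forall>\<^sub>F n in sequentially. \<tau>_at D S J n q \<le> ereal c"
    using assms eventually_gt_at_top[of 0]
    by eventually_elim (metis \<tau>_at_greater_iff not_less)
qed

text \<open>Constant factors disappear in the exponent.\<close>

lemma \<tau>_upper_le_constI:
  assumes "\<forall>\<^sub>F n in sequentially. power_sum n q \<le> C * 2 powr (c * real n)"
  shows "\<tau>_upper D S J q \<le> ereal c"
proof (rule ereal_le_epsilon2)
  fix e :: real assume "e > 0"
  have "\<forall>\<^sub>F n in sequentially. power_sum n q \<le> 2 powr ((c + e) * real n)"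
    using assms eventually_const_le_powr[OF \<open>e > 0\<close>, of C]
  proof eventually_elim
    case (elim n)
    have "C * 2 powr (c * real n) \<le> 2 powr (e * real n) * 2 powr (c * real n)"
      using elim(2) by (intro mult_right_mono) auto
    also have "\<dots> = 2 powr ((c + e) * real n)"
      by (simp add: powr_add[symmetric] algebra_simps)
    finally show ?case using elim(1) by linarith
  qed
  then show "\<tau>_upper D S J q \<le> ereal c + ereal e" using \<tau>_upper_leI by simp
qed

lemma \<tau>_upper_nonneg_below_\<qq>:
  assumes "q \<ge> 0" "ereal q < \<qq> D S J"
  shows "\<tau>_upper D S J q \<ge> 0"
proof (rule ccontr)
  assume "\<not> ?thesis"
  then have "ereal q \<in> ereal ` {q. q \<ge> 0 \<and> \<tau>_upper D S J q < 0}" using assms by auto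
  then show False using assms(2) unfolding \<qq>_def by (meson Inf_lower not_less)
qed

lemma \<qq>_le: "q \<ge> 0 \<Longrightarrow> \<tau>_upper D S J q < 0 \<Longrightarrow> \<qq> D S J \<le> ereal q"
  unfolding \<qq>_def by (rule Inf_lower) auto

lemma \<kappa>_le: "q \<ge> 0 \<Longrightarrow> (\<lambda>Q. J Q powr q) summable_on S \<Longrightarrow> \<kappa> S J \<le> ereal q"
  unfolding \<kappa>_def by (rule Inf_lower) auto

lemma \<qq>_nonneg: "0 \<le> \<qq> D S J"
  unfolding \<qq>_def by (rule Inf_greatest) auto

subsection \<open>Counting functions\<close>

lemma N_ratio_le_iff:
  assumes "n > 0" "c \<ge> 0"
  shows "log_plus (real (N D S J \<alpha> n)) / ln (2 ^ n) \<le> c \<longleftrightarrow> real (N D S J \<alpha> n) \<le> 2 powr (c * real n)"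
  using log_plus_ratio_le_iff[of "2 ^ n" c "real (N D S J \<alpha> n)"] assms
  by (simp add: two_power_powr)

lemma N_ratio_nonneg: "0 \<le> log_plus (real (N D S J \<alpha> n)) / ln (2 ^ n)"
  by (rule log_plus_ratio_nonneg) simp

lemma F_lower_at_nonneg: "0 \<le> F_lower_at D S J \<alpha>"
  unfolding F_lower_at_def
  by (rule Liminf_bounded) (use N_ratio_nonneg in \<open>simp add: zero_ereal_def\<close>)

lemma F_lower_at_le_upper: "F_lower_at D S J \<alpha> \<le> F_upper_at D S J \<alpha>"
  unfolding F_lower_at_def F_upper_at_def by (rule Liminf_le_Limsup) simp

lemma F_lower_ge:
  assumes "\<alpha> > 0" "ereal (c * \<alpha>) \<le> F_lower_at D S J \<alpha>"
  shows "ereal c \<le> F_lower D S J"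
proof -
  have "ereal c \<le> F_lower_at D S J \<alpha> / ereal \<alpha>"
    using assms by (cases "F_lower_at D S J \<alpha>") (auto simp: field_simps)
  also have "\<dots> \<le> F_lower D S J"
    unfolding F_lower_def using assms(1) by (intro SUP_upper) auto
  finally show ?thesis .
qed

lemma F_lower_nonneg: "0 \<le> F_lower D S J"
  using F_lower_ge[of 1 0] F_lower_at_nonneg[of 1] by (simp add: zero_ereal_def)

lemma F_lower_le_upper: "F_lower D S J \<le> F_upper D S J"
  unfolding F_lower_def F_upper_def
  by (intro SUP_mono bexI) (auto intro: ereal_divide_right_mono F_lower_at_le_upper)

lemma eventually_N_le:
  assumes "F_upper D S J < ereal q" "\<alpha> > 0" "q \<ge> 0"
  shows "\<forall>\<^sub>F n in sequentially. real (N D S J \<alpha> n) \<le> 2 powr (q * \<alpha> * real n)"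
proof -
  have "F_upper_at D S J \<alpha> / ereal \<alpha> \<le> F_upper D S J"
    unfolding F_upper_def using assms(2) by (intro SUP_upper) auto
  then have "F_upper_at D S J \<alpha> / ereal \<alpha> < ereal q" using assms(1) by (rule order_le_less_trans)
  then have "F_upper_at D S J \<alpha> < ereal (q * \<alpha>)"
    using assms(2) by (cases "F_upper_at D S J \<alpha>") (auto simp: field_simps)
  from Limsup_lessD[OF this[unfolded F_upper_at_def]] eventually_gt_at_top[of 0]
  show ?thesis
  proof eventually_elim
    case (elim n)
    then have "log_plus (real (N D S J \<alpha> n)) / ln (2 ^ n) \<le> q * \<alpha>" by (simp)
    then show ?case using N_ratio_le_iff[of n "q * \<alpha>"] elim(2) assms by simp
  qed
qed

lemma F_upper_at_leI:
  assumes "c \<ge> 0" "\<forall>\<^sub>F n in sequentially. real (N D S J \<alpha> n) \<le> 2 powr (c * real n)"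
  shows "F_upper_at D S J \<alpha> \<le> ereal c"
  unfolding F_upper_at_def
proof (rule Limsup_bounded)
  show "\<forall>\<^sub>F n in sequentially. ereal (log_plus (real (N D S J \<alpha> n)) / ln (2 ^ n)) \<le> ereal c"
    using assms(2) eventually_gt_at_top[of 0]
    by eventually_elim (use N_ratio_le_iff assms(1) in \<open>simp\<close>)
qed

text \<open>
  The factor \<open>C\<close> costs an arbitrarily small part of the exponent; negative exponents need no
  bound, since \<open>F_lower_at\<close> is nonnegative.
\<close>

lemma F_lower_at_geI:
  assumes "\<forall>\<^sub>F n in sequentially. 2 powr (c * real n) \<le> C * real (N D S J \<alpha> n)"
  shows "ereal c \<le> F_lower_at D S J \<alpha>"
proof (rule dense_le)
  fix y assume "y < ereal c"
  then obtain d where d: "y < ereal d" "d < c" using ereal_dense2 by force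
  have "ereal d \<le> F_lower_at D S J \<alpha>"
  proof (cases "d \<ge> 0")
    case True
    have "\<forall>\<^sub>F n in sequentially. C + 1 \<le> 2 powr ((c - d) * real n)"
      using eventually_const_le_powr d(2) by simp
    with assms eventually_gt_at_top[of 0]
    have "\<forall>\<^sub>F n in sequentially. ereal d \<le> ereal (log_plus (real (N D S J \<alpha> n)) / ln (2 ^ n))"
    proof eventually_elim
      case (elim n)
      have "2 powr ((c - d) * real n) * 2 powr (d * real n) = 2 powr (c * real n)"
        by (simp add: powr_add[symmetric] algebra_simps)
      then have "(C + 1) * 2 powr (d * real n) \<le> C * real (N D S J \<alpha> n)"
        using elim mult_right_mono[of "C + 1" "2 powr ((c - d) * real n)" "2 powr (d * real n)"]
        by simp
      moreover have "C > 0"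
      proof (rule ccontr)
        assume "\<not> C > 0"
        then have "C * real (N D S J \<alpha> n) \<le> 0" by (simp add: mult_nonpos_nonneg)
        moreover have "0 < 2 powr (c * real n)" by simp
        ultimately show False using elim(1) by linarith
      qed
      ultimately have "C * 2 powr (d * real n) < C * real (N D S J \<alpha> n)"
        using powr_gt_zero[of 2 "d * real n"] unfolding distrib_right by linarith
      then have "\<not> real (N D S J \<alpha> n) \<le> 2 powr (d * real n)" using \<open>C > 0\<close> by simp
      then show ?case using N_ratio_le_iff[of n d \<alpha>] True elim(2) by (simp)
    qed
    then show ?thesis unfolding F_lower_at_def by (rule Liminf_bounded)
  next
    case False
    then have "ereal d \<le> 0" by simp
    then show ?thesis using F_lower_at_nonneg by (rule order_trans)
  qed
  then show "y \<le> F_lower_at D S J \<alpha>" using d(1) by simp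
qed

lemma eventually_N_greater:
  assumes "ereal c < F_lower_at D S J \<alpha>" "c \<ge> 0"
  shows "\<forall>\<^sub>F n in sequentially. 2 powr (c * real n) < real (N D S J \<alpha> n)"
  using less_LiminfD[OF assms(1)[unfolded F_lower_at_def]] eventually_gt_at_top[of 0]
proof eventually_elim
  case (elim n)
  then show ?case using N_ratio_le_iff[of n c \<alpha>] assms(2) by (simp)
qed

end

section \<open>Exponential decay\<close>

locale decaying_set_function = partition_set_function Q0 D S J
  for Q0 :: "(real ^ 'd) set" and D S J +
  assumes dim_pos: "dim_infty D S J > 0"
begin

lemma eventually_decay:
  obtains \<delta> where "\<delta> > 0"
    "\<forall>\<^sub>F n in sequentially. \<forall>Q\<in>level D S n. J Q \<le> 2 powr (- \<delta> * real n)"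
proof -
  obtain \<delta> where \<delta>: "0 < ereal \<delta>" "ereal \<delta> < dim_infty D S J"
    using ereal_dense2[OF dim_pos] by blast
  have "\<forall>\<^sub>F n in sequentially. \<forall>Q\<in>level D S n. J Q \<le> 2 powr (- \<delta> * real n)"
    using less_LiminfD[OF \<delta>(2)[unfolded dim_infty_def]] eventually_gt_at_top[of 0]
  proof eventually_elim
    case (elim n)
    define m where "m = Max (J ` level D S n)"
    have "m \<le> 2 powr (- \<delta> * real n)"
    proof (cases "m > 0")
      case True
      have "(1::real) < 2 ^ n" using elim(2) by simp
      then have "ln (2 ^ n :: real) > 0" "(2::real) ^ n \<noteq> 1" by (auto simp only: ln_gt_zero)
      then have "\<delta> < ln m / (- ln (2 ^ n))"
        using elim(1) True by (simp add: elog_def m_def)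
      then have "ln m < - \<delta> * real n * ln 2"
        using elim(2) by (simp add: field_simps ln_realpow)
      then have "ln m < ln (2 powr (- \<delta> * real n))" by simp
      then show ?thesis using True by (simp only: ln_less_cancel_iff powr_gt_zero)
    next
      case False
      then show ?thesis by (meson not_less order_trans powr_ge_zero)
    qed
    then show ?case
      using finite_level[of n] by (auto simp: m_def intro: order_trans[OF Max_ge])
  qed
  with \<delta>(1) show ?thesis by (intro that) auto
qed

lemma eventually_le_one: "\<forall>\<^sub>F n in sequentially. \<forall>Q\<in>level D S n. J Q \<le> 1"
proof -
  obtain \<delta> where \<delta>: "\<delta> > 0"
    "\<forall>\<^sub>F n in sequentially. \<forall>Q\<in>level D S n. J Q \<le> 2 powr (- \<delta> * real n)"
    using eventually_decay .
  from \<delta>(2) show ?thesis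
  proof eventually_elim
    case (elim n)
    have "2 powr (- \<delta> * real n) \<le> (2::real) powr 0" using \<delta>(1) by (intro powr_mono) auto
    then show ?case using elim by force
  qed
qed

text \<open>
  Since the values on a late level \<open>n\<close> are at most \<open>2 powr (- \<delta> n)\<close>, increasing the exponent by \<open>t\<close>
  shrinks every summand at least by the factor \<open>2 powr (- \<delta> t n)\<close>.
\<close>

lemma power_sum_decay:
  obtains \<delta> where "\<delta> > 0"
    "\<And>q q'. q \<le> q' \<Longrightarrow> \<forall>\<^sub>F n in sequentially. power_sum n q' \<le> 2 powr (- \<delta> * (q' - q) * real n) * power_sum n q"
proof -
  obtain \<delta> where \<delta>: "\<delta> > 0"
    "\<forall>\<^sub>F n in sequentially. \<forall>Q\<in>level D S n. J Q \<le> 2 powr (- \<delta> * real n)"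
    using eventually_decay .
  have "\<forall>\<^sub>F n in sequentially. power_sum n q' \<le> 2 powr (- \<delta> * (q' - q) * real n) * power_sum n q"
    if "q \<le> q'" for q q'
    using \<delta>(2)
  proof eventually_elim
    case (elim n)
    have "J Q powr q' \<le> 2 powr (- \<delta> * (q' - q) * real n) * J Q powr q" if Q: "Q \<in> level D S n" for Q
    proof -
      have "J Q powr q' = J Q powr (q' - q) * J Q powr q" by (simp add: powr_add[symmetric])
      also have "\<dots> \<le> (2 powr (- \<delta> * real n)) powr (q' - q) * J Q powr q"
        using elim Q level_nonneg[OF Q] \<open>q \<le> q'\<close> by (intro mult_right_mono powr_mono2) auto
      finally show ?thesis by (simp add: powr_powr algebra_simps)
    qed
    then show ?case unfolding sum_distrib_left by (intro sum_mono)
  qed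
  with \<delta>(1) show ?thesis by (rule that)
qed

lemma \<tau>_upper_decay:
  obtains \<delta> where "\<delta> > 0"
    "\<And>q q' c. q \<le> q' \<Longrightarrow> \<tau>_upper D S J q \<le> ereal c \<Longrightarrow> \<tau>_upper D S J q' \<le> ereal (c - \<delta> * (q' - q))"
proof -
  obtain \<delta> where \<delta>: "\<delta> > 0"
    "\<And>q q'. q \<le> q' \<Longrightarrow> \<forall>\<^sub>F n in sequentially. power_sum n q' \<le> 2 powr (- \<delta> * (q' - q) * real n) * power_sum n q"
    using power_sum_decay by blast
  have "\<tau>_upper D S J q' \<le> ereal (c - \<delta> * (q' - q))"
    if "q \<le> q'" "\<tau>_upper D S J q \<le> ereal c" for q q' c
  proof (rule ereal_le_epsilon2)
    fix e :: real assume "e > 0"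
    have "\<tau>_upper D S J q < ereal (c + e)" using that(2) \<open>e > 0\<close> by (simp add: order_le_less_trans)
    from eventually_power_sum_less[OF this] \<delta>(2)[OF that(1)]
    have "\<forall>\<^sub>F n in sequentially. power_sum n q' \<le> 2 powr ((c - \<delta> * (q' - q) + e) * real n)"
    proof eventually_elim
      case (elim n)
      have "2 powr (- \<delta> * (q' - q) * real n) * power_sum n q
          \<le> 2 powr (- \<delta> * (q' - q) * real n) * 2 powr ((c + e) * real n)"
        using elim(1) by (intro mult_left_mono) auto
      also have "\<dots> = 2 powr ((c - \<delta> * (q' - q) + e) * real n)"
        by (simp add: powr_add[symmetric] algebra_simps)
      finally show ?case using elim(2) by linarith
    qed
    then show "\<tau>_upper D S J q' \<le> ereal (c - \<delta> * (q' - q)) + ereal e"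
      using \<tau>_upper_leI by simp
  qed
  with \<delta>(1) show ?thesis by (rule that)
qed

lemma \<tau>_upper_le_dim:
  assumes "q \<ge> 0"
  shows "\<tau>_upper D S J q \<le> ereal (real CARD('d))"
proof (rule \<tau>_upper_leI)
  show "\<forall>\<^sub>F n in sequentially. power_sum n q \<le> 2 powr (real CARD('d) * real n)"
    using eventually_le_one
  proof eventually_elim
    case (elim n)
    have "power_sum n q \<le> (\<Sum>Q\<in>level D S n. 1)"
      using elim assms level_nonneg by (intro sum_mono powr_le1) auto
    then show ?case using card_level_S[of n] by simp
  qed
qed

text \<open>
  A level has at most \<open>2 powr (d n)\<close> cubes, so \<open>\<tau>_upper 0 \<le> d\<close>, and the decay makes
  \<open>\<tau>_upper\<close> negative once the exponent exceeds \<open>d / \<delta>\<close>.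
\<close>

lemma \<qq>_finite: "\<qq> D S J < \<infinity>"
proof -
  obtain \<delta> where \<delta>: "\<delta> > 0"
    "\<And>q q' c. q \<le> q' \<Longrightarrow> \<tau>_upper D S J q \<le> ereal c \<Longrightarrow> \<tau>_upper D S J q' \<le> ereal (c - \<delta> * (q' - q))"
    using \<tau>_upper_decay by blast
  define p where "p = (real CARD('d) + 1) / \<delta>"
  have "p \<ge> 0" using \<delta>(1) by (simp add: p_def)
  then have "\<tau>_upper D S J p \<le> ereal (real CARD('d) - \<delta> * (p - 0))"
    using \<delta>(2)[of 0 p] \<tau>_upper_le_dim[of 0] by simp
  also have "\<dots> = ereal (-1)" using \<delta>(1) by (simp add: p_def)
  also have "\<dots> < 0" by simp
  finally have "\<qq> D S J \<le> ereal p" using \<qq>_le \<open>p \<ge> 0\<close> by simp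
  then show ?thesis by (meson ereal_infty_less(1) ereal_less_PInfty ereal_less_eq(1) order_le_less_trans PInfty_neq_ereal(1))
qed

text \<open>Strictly below \<open>\<qq>\<close> the exponent is strictly positive, again because of the decay.\<close>

lemma \<tau>_upper_pos_below_\<qq>:
  assumes "q \<ge> 0" "ereal q < \<qq> D S J"
  obtains y where "y > 0" "\<tau>_upper D S J q = ereal y"
proof -
  obtain \<delta> where \<delta>: "\<delta> > 0"
    "\<And>q q' c. q \<le> q' \<Longrightarrow> \<tau>_upper D S J q \<le> ereal c \<Longrightarrow> \<tau>_upper D S J q' \<le> ereal (c - \<delta> * (q' - q))"
    using \<tau>_upper_decay by blast
  have nn: "\<tau>_upper D S J q \<ge> 0" using assms by (rule \<tau>_upper_nonneg_below_\<qq>)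
  then obtain y where y: "\<tau>_upper D S J q = ereal y"
    using \<tau>_upper_le_dim[OF assms(1)] by (cases "\<tau>_upper D S J q") auto
  obtain q' where q': "ereal q < ereal q'" "ereal q' < \<qq> D S J" using ereal_dense2[OF assms(2)] by blast
  have "0 \<le> \<tau>_upper D S J q'" using q' assms(1) by (intro \<tau>_upper_nonneg_below_\<qq>) auto
  also have "\<dots> \<le> ereal (y - \<delta> * (q' - q))" using \<delta>(2)[of q q' y] q'(1) y by simp
  finally have "\<delta> * (q' - q) \<le> y" by simp
  moreover have "\<delta> * (q' - q) > 0" using \<delta>(1) q'(1) by simp
  ultimately show ?thesis by (intro that[OF _ y]) linarith
qed

section \<open>Summability and the partition function\<close>

lemma summable_power_sum:
  assumes "\<tau>_upper D S J q < 0"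
  shows "summable (\<lambda>n. power_sum n q)"
proof -
  obtain c where c: "\<tau>_upper D S J q < ereal c" "ereal c < 0" using ereal_dense2[OF assms] by blast
  show ?thesis
  proof (rule summable_comparison_test_ev)
    show "\<forall>\<^sub>F n in sequentially. norm (power_sum n q) \<le> (2 powr c) ^ n"
      using eventually_power_sum_less[OF c(1)]
    proof eventually_elim
      case (elim n)
      then show ?case using power_sum_nonneg[of q n] by (simp add: powr_realpow[symmetric] powr_powr)
    qed
    have "2 powr c < (2::real) powr 0" using c(2) by (intro powr_less_mono) auto
    then show "summable (\<lambda>n. (2 powr c) ^ n)" by (intro summable_geometric) simp
  qed
qed

lemma partial_sum_le_suminf:
  assumes "\<tau>_upper D S J q < 0"
  shows "(\<Sum>n<m. power_sum n q) \<le> (\<Sum>n. power_sum n q)"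
  using summable_power_sum[OF assms] power_sum_nonneg by (intro sum_le_suminf) auto

lemma summable_if_\<tau>_upper_neg:
  assumes "\<tau>_upper D S J q < 0"
  shows "(\<lambda>Q. J Q powr q) summable_on S"
proof -
  show ?thesis
  proof (rule nonneg_bdd_above_summable_on)
    show "bdd_above (sum (\<lambda>Q. J Q powr q) ` {F. F \<subseteq> S \<and> finite F})"
    proof (rule bdd_aboveI2)
      fix F assume "F \<in> {F. F \<subseteq> S \<and> finite F}"
      then have F: "F \<subseteq> S" "finite F" by auto
      then obtain lev where lev: "\<And>Q. Q \<in> F \<Longrightarrow> Q \<in> level D S (lev Q)"
        using subset unfolding level_def by (metis IntI UN_E subsetD)
      obtain m where m: "\<And>Q. Q \<in> F \<Longrightarrow> lev Q < m"
        using F(2) finite_nat_set_iff_bounded[of "lev ` F"] by auto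
      have "sum (\<lambda>Q. J Q powr q) F \<le> (\<Sum>(n, Q)\<in>Sigma {..<m} (level D S). J Q powr q)"
        using F(2) lev m finite_level by (intro sum_le_included[where i = snd]) force+
      also have "\<dots> = (\<Sum>n<m. power_sum n q)"
        using finite_level by (intro sum.Sigma[symmetric]) auto
      also have "\<dots> \<le> (\<Sum>n. power_sum n q)" by (rule partial_sum_le_suminf[OF assms])
      finally show "sum (\<lambda>Q. J Q powr q) F \<le> (\<Sum>n. power_sum n q)" .
    qed
  qed simp
qed

lemma power_sum_le_infsum:
  assumes "(\<lambda>Q. J Q powr q) summable_on S"
  shows "power_sum n q \<le> infsum (\<lambda>Q. J Q powr q) S"
  using assms finite_level by (intro finite_sum_le_infsum) (auto simp: level_def)

text \<open>
  Summability bounds the power sums, so the exponent is at most \<open>0\<close> at \<open>q\<close>; the decay makes it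
  negative at every larger \<open>q'\<close>.
\<close>

lemma \<tau>_upper_neg_if_summable:
  assumes "(\<lambda>Q. J Q powr q) summable_on S" "q < q'"
  shows "\<tau>_upper D S J q' < 0"
proof -
  obtain \<delta> where \<delta>: "\<delta> > 0"
    "\<And>q q' c. q \<le> q' \<Longrightarrow> \<tau>_upper D S J q \<le> ereal c \<Longrightarrow> \<tau>_upper D S J q' \<le> ereal (c - \<delta> * (q' - q))"
    using \<tau>_upper_decay by blast
  have "\<tau>_upper D S J q \<le> ereal 0"
    by (rule \<tau>_upper_le_constI[where C = "infsum (\<lambda>Q. J Q powr q) S"])
      (use power_sum_le_infsum[OF assms(1)] in simp)
  then have "\<tau>_upper D S J q' \<le> ereal (0 - \<delta> * (q' - q))" using \<delta>(2)[of q q' 0] assms(2) by simp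
  also have "\<dots> < 0" using \<delta>(1) assms(2) by simp
  finally show ?thesis .
qed

theorem \<qq>_eq_\<kappa>: "\<qq> D S J = \<kappa> S J"
proof (rule antisym)
  show "\<kappa> S J \<le> \<qq> D S J"
    unfolding \<qq>_def using \<kappa>_le summable_if_\<tau>_upper_neg by (intro Inf_greatest) auto
  have "\<qq> D S J \<le> ereal q" if q: "q \<ge> 0" "(\<lambda>Q. J Q powr q) summable_on S" for q
  proof (rule ereal_le_epsilon2)
    fix e :: real assume "e > 0"
    then show "\<qq> D S J \<le> ereal q + ereal e"
      using \<qq>_le[of "q + e"] \<tau>_upper_neg_if_summable[OF q(2)] q(1) by simp
  qed
  then show "\<qq> D S J \<le> \<kappa> S J" unfolding \<kappa>_def by (intro Inf_greatest) auto
qed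

section \<open>The counting exponents and the partition function\<close>

text \<open>Markov's inequality on one level.\<close>

lemma card_large_le_power_sum:
  assumes "t > 0" "q \<ge> 0"
  shows "real (card {Q \<in> level D S n. t \<le> J Q}) * t powr q \<le> power_sum n q"
proof -
  have "real (card {Q \<in> level D S n. t \<le> J Q}) * t powr q = (\<Sum>Q | Q \<in> level D S n \<and> t \<le> J Q. t powr q)"
    by simp
  also have "\<dots> \<le> (\<Sum>Q | Q \<in> level D S n \<and> t \<le> J Q. J Q powr q)"
    using assms by (intro sum_mono powr_mono2) auto
  also have "\<dots> \<le> power_sum n q"
    using finite_level by (intro sum_mono2) auto
  finally show ?thesis .
qed

lemma F_upper_le_\<qq>: "F_upper D S J \<le> \<qq> D S J"
proof -
  have "F_upper D S J \<le> ereal q" if q: "q \<ge> 0" "\<tau>_upper D S J q < 0" for q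
    unfolding F_upper_def
  proof (rule SUP_least)
    fix \<alpha> :: real assume "\<alpha> \<in> {0<..}"
    then have \<alpha>: "\<alpha> > 0" by simp
    have "\<tau>_upper D S J q < ereal 0" using q(2) by (simp add: zero_ereal_def)
    from eventually_power_sum_less[OF this]
    have "\<forall>\<^sub>F n in sequentially. real (N D S J \<alpha> n) \<le> 2 powr (q * \<alpha> * real n)"
    proof (rule eventually_mono)
      fix n assume "power_sum n q < 2 powr (0 * real n)"
      then have "real (N D S J \<alpha> n) * (2 powr (- \<alpha> * real n)) powr q \<le> 1"
        using card_large_le_power_sum[of "2 powr (- \<alpha> * real n)" q n] q(1) by (simp add: N_def)
      moreover have "(2 powr (- \<alpha> * real n)) powr q = 1 / 2 powr (q * \<alpha> * real n)"
        unfolding powr_powr powr_minus_divide[symmetric] by (simp add: algebra_simps)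
      ultimately show "real (N D S J \<alpha> n) \<le> 2 powr (q * \<alpha> * real n)"
        by (simp add: pos_divide_le_eq)
    qed
    then have "F_upper_at D S J \<alpha> \<le> ereal (q * \<alpha>)"
      using q(1) \<alpha> by (intro F_upper_at_leI) auto
    then show "F_upper_at D S J \<alpha> / ereal \<alpha> \<le> ereal q"
      using \<alpha> by (cases "F_upper_at D S J \<alpha>") (auto simp: field_simps)
  qed
  then show ?thesis unfolding \<qq>_def by (intro Inf_greatest) auto
qed

text \<open>
  A cube with value at least \<open>2 powr (- K \<eta> n)\<close> has its value in one of the \<open>K\<close> classes
  between \<open>2 powr (- (i + 1) \<eta> n)\<close> and \<open>2 powr (- i \<eta> n)\<close>, and the number of cubes in this
  class is at most \<open>N ((i + 1) \<eta>) n\<close>. Each other cube contributes at most \<open>2 powr (- d n)\<close>, because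
  \<open>d \<le> K \<eta> q\<close>, and there are at most \<open>2 powr (d n)\<close> of them.
\<close>

lemma power_sum_le_grid:
  assumes "\<eta> > 0" "q > 0" "K > 0" "real CARD('d) \<le> real K * \<eta> * q"
    and le1: "\<forall>Q\<in>level D S n. J Q \<le> 1"
  shows "power_sum n q \<le> 1 + (\<Sum>i<K. real (N D S J (real (Suc i) * \<eta>) n) * 2 powr (- (real i * \<eta> * q * real n)))"
proof -
  define P where "P = (\<lambda>i Q. 2 powr (- (real (Suc i) * \<eta>) * real n) \<le> J Q)"
  define w where "w = (\<lambda>i::nat. 2 powr (- (real i * \<eta> * q * real n)))"
  have w_nonneg: "w i \<ge> 0" for i by (simp add: w_def)
  have pow: "(2 powr (- (real i * \<eta>) * real n)) powr q = w i" for i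
    by (simp add: w_def powr_powr algebra_simps)
  have single: "J Q powr q \<le> 2 powr (- real CARD('d) * real n) + (\<Sum>i<K. if P i Q then w i else 0)"
    if Q: "Q \<in> level D S n" for Q
  proof (cases "\<exists>i<K. P i Q")
    case True
    \<comment> \<open>By minimality the value lies below the next higher threshold, for \<open>i = 0\<close> below \<open>1\<close>.\<close>
    define i where "i = (LEAST i. P i Q)"
    have Pi: "P i Q" unfolding i_def using True by (metis LeastI)
    have iK: "i < K" unfolding i_def using True by (meson Least_le order_le_less_trans)
    have "J Q \<le> 2 powr (- (real i * \<eta>) * real n)"
    proof (cases i)
      case 0
      then show ?thesis using le1 Q by simp
    next
      case (Suc k)
      then have "\<not> P k Q" unfolding i_def using not_less_Least[of k "\<lambda>i. P i Q"] by simp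
      then show ?thesis by (simp add: P_def Suc)
    qed
    then have "J Q powr q \<le> w i"
      using powr_mono2[of q "J Q"] assms(2) level_nonneg[OF Q] pow[of i] by fastforce
    also have "w i = (if P i Q then w i else 0)" using Pi by simp
    also have "\<dots> \<le> (\<Sum>i<K. if P i Q then w i else 0)"
      using iK w_nonneg by (intro member_le_sum) auto
    finally show ?thesis by (simp add: add_increasing)
  next
    case False
    then have "\<not> P (K - 1) Q" using assms(3) by auto
    then have "J Q \<le> 2 powr (- (real K * \<eta>) * real n)" using assms(3) by (simp add: P_def)
    then have "J Q powr q \<le> w K"
      using powr_mono2[of q "J Q"] assms(2) level_nonneg[OF Q] pow[of K] by fastforce
    also have "\<dots> \<le> 2 powr (- real CARD('d) * real n)"
      unfolding w_def using mult_right_mono[OF assms(4), of "real n"] by (intro powr_mono) auto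
    also have "\<dots> \<le> \<dots> + (\<Sum>i<K. if P i Q then w i else 0)"
      using w_nonneg by (simp add: sum_nonneg)
    finally show ?thesis .
  qed
  have "power_sum n q \<le> (\<Sum>Q\<in>level D S n. 2 powr (- real CARD('d) * real n) + (\<Sum>i<K. if P i Q then w i else 0))"
    using single by (rule sum_mono)
  also have "\<dots> = real (card (level D S n)) * 2 powr (- real CARD('d) * real n)
      + (\<Sum>Q\<in>level D S n. \<Sum>i<K. if P i Q then w i else 0)"
    by (simp add: sum.distrib)
  also have "(\<Sum>Q\<in>level D S n. \<Sum>i<K. if P i Q then w i else 0)
      = (\<Sum>i<K. real (N D S J (real (Suc i) * \<eta>) n) * w i)"
    by (subst sum.swap) (simp add: sum.If_cases finite_level N_def P_def Int_def)
  also have "real (card (level D S n)) * 2 powr (- real CARD('d) * real n) \<le> 1"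
  proof -
    have "real (card (level D S n)) * 2 powr (- real CARD('d) * real n)
        \<le> 2 powr (real CARD('d) * real n) * 2 powr (- real CARD('d) * real n)"
      using card_level_S by (intro mult_right_mono) auto
    then show ?thesis by (simp add: powr_add[symmetric])
  qed
  finally show ?thesis by (simp add: w_def)
qed

text \<open>
  If \<open>F_upper < q < \<qq>\<close>, then eventually \<open>N \<alpha> n \<le> 2 powr (q \<alpha> n)\<close>, so each class of the grid
  contributes at most \<open>2 powr (\<eta> q n)\<close> to the power sum. Hence \<open>\<tau>_upper q \<le> \<eta> q\<close>, although
  \<open>\<tau>_upper q\<close> is a fixed positive number and the mesh \<open>\<eta>\<close> can be chosen arbitrarily small.
\<close>

lemma \<qq>_le_F_upper: "\<qq> D S J \<le> F_upper D S J"
proof (rule ccontr)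
  assume "\<not> ?thesis"
  then have "F_upper D S J < \<qq> D S J" by (simp add: not_le)
  then obtain q where q: "F_upper D S J < ereal q" "ereal q < \<qq> D S J"
    using ereal_dense2 by blast
  have "0 \<le> F_upper D S J" using F_lower_nonneg F_lower_le_upper by (rule order_trans)
  then have "0 < ereal q" using q(1) by (rule order_le_less_trans)
  then have "q > 0" by simp
  then obtain y where y: "y > 0" "\<tau>_upper D S J q = ereal y"
    using \<tau>_upper_pos_below_\<qq>[of q] q(2) by auto
  define \<eta> where "\<eta> = y / (2 * q)"
  have \<eta>: "\<eta> > 0" using y(1) \<open>q > 0\<close> by (simp add: \<eta>_def)
  obtain K0 where "real CARD('d) / (\<eta> * q) \<le> real K0" using real_arch_simple by blast
  then have K0: "real CARD('d) \<le> real K0 * (\<eta> * q)" using \<eta> \<open>q > 0\<close> by (simp add: pos_divide_le_eq)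
  define K where "K = Suc K0"
  have K: "K > 0" "real CARD('d) \<le> real K * \<eta> * q"
    using K0 mult_pos_pos[OF \<eta> \<open>q > 0\<close>] by (auto simp: K_def algebra_simps)
  have "\<forall>\<^sub>F n in sequentially. \<forall>i\<in>{..<K}.
      real (N D S J (real (Suc i) * \<eta>) n) \<le> 2 powr (q * (real (Suc i) * \<eta>) * real n)"
    using \<eta> \<open>q > 0\<close> by (intro eventually_ball_finite ballI eventually_N_le[OF q(1)]) auto
  with eventually_le_one
  have "\<forall>\<^sub>F n in sequentially. power_sum n q \<le> (1 + real K) * 2 powr (\<eta> * q * real n)"
  proof eventually_elim
    case (elim n)
    have "power_sum n q
        \<le> 1 + (\<Sum>i<K. real (N D S J (real (Suc i) * \<eta>) n) * 2 powr (- (real i * \<eta> * q * real n)))"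
      using \<eta> \<open>q > 0\<close> K elim(1) by (rule power_sum_le_grid)
    also have "\<dots> \<le> 1 + (\<Sum>i<K. 2 powr (q * (real (Suc i) * \<eta>) * real n) * 2 powr (- (real i * \<eta> * q * real n)))"
      using elim(2) by (intro add_left_mono sum_mono mult_right_mono) auto
    also have "\<dots> = 1 + real K * 2 powr (\<eta> * q * real n)"
      by (simp add: powr_add[symmetric] algebra_simps)
    also have "1 \<le> 2 powr (\<eta> * q * real n)"
      using \<eta> \<open>q > 0\<close> by (intro ge_one_powr_ge_zero) auto
    finally show ?case by (simp add: distrib_right)
  qed
  then have "\<tau>_upper D S J q \<le> ereal (\<eta> * q)" by (rule \<tau>_upper_le_constI)
  then show False using y \<open>q > 0\<close> by (simp add: \<eta>_def)
qed

section \<open>The partition entropy\<close>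

lemma eventually_levels_small:
  assumes "x > 0"
  obtains m where "\<And>n Q. m \<le> n \<Longrightarrow> Q \<in> level D S n \<Longrightarrow> J Q < 1 / x"
proof -
  have "0 < ereal (1 / x)" using assms by simp
  then have "\<forall>\<^sub>F n in sequentially. sup_from D S J n < ereal (1 / x)"
    using uniformly_vanishing by (rule order_tendstoD(2)[rotated])
  then obtain m where m: "sup_from D S J m < ereal (1 / x)"
    by (auto simp: eventually_sequentially)
  show ?thesis
  proof (rule that)
    fix n Q assume "m \<le> n" "Q \<in> level D S n"
    then have "ereal (J Q) \<le> sup_from D S J m"
      unfolding sup_from_def by (intro SUP_upper) auto
    then have "ereal (J Q) < ereal (1 / x)" using m by (rule order_le_less_trans)
    then show "J Q < 1 / x" by simp
  qed
qed

text \<open>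
  The levels are kept apart in the following union, because the children of a cube are
  children with respect to its level.
\<close>

lemma G_subset_children:
  assumes "\<And>n Q. m \<le> n \<Longrightarrow> Q \<in> level D S n \<Longrightarrow> J Q < 1 / x"
  shows "G D S J x \<subseteq> (\<Union>n<m. \<Union>Q\<in>{Q \<in> level D S n. 1 / x \<le> J Q}. {R \<in> D (Suc n). R \<subseteq> Q})"
proof
  fix R assume "R \<in> G D S J x"
  then obtain n Q where nQ: "R \<in> D (Suc n)" "Q \<in> level D S n" "R \<subseteq> Q" "1 / x \<le> J Q"
    by (auto simp: G_def)
  then have "n < m" using assms by (meson not_less)
  then show "R \<in> (\<Union>n<m. \<Union>Q\<in>{Q \<in> level D S n. 1 / x \<le> J Q}. {R \<in> D (Suc n). R \<subseteq> Q})"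
    using nQ by blast
qed

lemma finite_G:
  assumes "x > 0"
  shows "finite (G D S J x)"
proof -
  obtain m where "\<And>n Q. m \<le> n \<Longrightarrow> Q \<in> level D S n \<Longrightarrow> J Q < 1 / x"
    using eventually_levels_small[OF assms] by blast
  from G_subset_children[OF this] show ?thesis
    by (rule finite_subset) (use card_level finite_level in auto)
qed

text \<open>
  Each cube of \<open>G x\<close> is one of at most \<open>2 ^ d\<close> children of a cube of value at least \<open>1 / x\<close>, and
  Markov's inequality counts those cubes on each level.
\<close>

lemma M_le:
  assumes "x > 0" "q \<ge> 0" "\<tau>_upper D S J q < 0"
  shows "real (M D S J x) \<le> 2 ^ CARD('d) * x powr q * (\<Sum>n. power_sum n q)"
proof -
  obtain m where m: "\<And>n Q. m \<le> n \<Longrightarrow> Q \<in> level D S n \<Longrightarrow> J Q < 1 / x"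
    using eventually_levels_small[OF assms(1)] by blast
  let ?L = "\<lambda>n. {Q \<in> level D S n. 1 / x \<le> J Q}"
  let ?C = "\<lambda>n Q. {R \<in> D (Suc n). R \<subseteq> Q}"
  have "M D S J x \<le> card (\<Union>n<m. \<Union>Q\<in>?L n. ?C n Q)"
    unfolding M_def by (intro card_mono G_subset_children m) (use card_level finite_level in auto)
  also have "\<dots> \<le> (\<Sum>n<m. card (\<Union>Q\<in>?L n. ?C n Q))" by (rule card_UN_le) simp
  also have "\<dots> \<le> (\<Sum>n<m. \<Sum>Q\<in>?L n. card (?C n Q))"
    using finite_level by (intro sum_mono card_UN_le) auto
  also have "\<dots> \<le> (\<Sum>n<m. \<Sum>Q\<in>?L n. 2 ^ CARD('d))"
    using card_children by (intro sum_mono) (auto simp: level_def)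
  finally have "real (M D S J x) \<le> real (\<Sum>n<m. card (?L n) * 2 ^ CARD('d))"
    by (intro of_nat_mono) simp
  also have "\<dots> = (\<Sum>n<m. 2 ^ CARD('d) * x powr q * (real (card (?L n)) * (1 / x) powr q))"
    using assms(1) by (simp add: powr_divide mult.commute)
  also have "\<dots> \<le> (\<Sum>n<m. 2 ^ CARD('d) * x powr q * power_sum n q)"
    using assms by (intro sum_mono mult_left_mono card_large_le_power_sum) auto
  also have "\<dots> = 2 ^ CARD('d) * x powr q * (\<Sum>n<m. power_sum n q)"
    by (simp only: sum_distrib_left)
  also have "\<dots> \<le> 2 ^ CARD('d) * x powr q * (\<Sum>n. power_sum n q)"
    using partial_sum_le_suminf[OF assms(3)] by (intro mult_left_mono) auto
  finally show ?thesis .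
qed

lemma h_upper_le_\<qq>: "h_upper D S J \<le> \<qq> D S J"
proof -
  have "h_upper D S J \<le> ereal q" if q: "q \<ge> 0" "\<tau>_upper D S J q < 0" for q
  proof (rule ereal_le_epsilon2)
    fix e :: real assume "e > 0"
    define C where "C = 2 ^ CARD('d) * (\<Sum>n. power_sum n q)"
    have "\<forall>\<^sub>F x in at_top. C \<le> x powr e" using \<open>e > 0\<close> by real_asymp
    then have "\<forall>\<^sub>F x in at_top. elog (real (M D S J x)) / ereal (ln x) \<le> ereal (q + e)"
      using eventually_gt_at_top[of 1]
    proof eventually_elim
      case (elim x)
      have "real (M D S J x) \<le> C * x powr q"
        using M_le[of x q] q elim(2) by (simp add: C_def algebra_simps)
      also have "\<dots> \<le> x powr e * x powr q" using elim(1) by (intro mult_right_mono) auto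
      also have "\<dots> = x powr (q + e)" by (simp add: powr_add)
      finally show ?case using elog_ratio_greater_iff[OF elim(2)] by (meson not_less)
    qed
    then show "h_upper D S J \<le> ereal q + ereal e"
      unfolding h_upper_def by (simp add: Limsup_bounded)
  qed
  then show ?thesis unfolding \<qq>_def by (intro Inf_greatest) auto
qed

text \<open>
  Following children of positive value downwards from a cube of value at least \<open>1 / x\<close>, the
  values must fall below \<open>1 / x\<close> at some level, and the first cube below the threshold belongs
  to \<open>G x\<close>.
\<close>

lemma G_below_large_cube:
  assumes "x > 0" "Q \<in> level D S n" "1 / x \<le> J Q"
  shows "\<exists>R\<in>G D S J x. R \<subseteq> Q \<and> R \<noteq> {}"
proof (rule ccontr)
  assume no: "\<not> ?thesis"
  obtain m where m: "\<And>n Q. m \<le> n \<Longrightarrow> Q \<in> level D S n \<Longrightarrow> J Q < 1 / x"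
    using eventually_levels_small[OF assms(1)] by blast
  have "\<exists>R\<in>level D S (n + k). R \<subseteq> Q \<and> 1 / x \<le> J R" for k
  proof (induction k)
    case 0
    then show ?case using assms by auto
  next
    case (Suc k)
    then obtain R where R: "R \<in> level D S (n + k)" "R \<subseteq> Q" "1 / x \<le> J R" by auto
    have "0 < 1 / x" using assms(1) by simp
    then have "J R > 0" using R(3) by linarith
    then obtain R' where R': "R' \<in> level D S (Suc (n + k))" "R' \<subseteq> R"
      using locally_nonvanishing[OF R(1)] by auto
    have "R' \<noteq> {}" using R'(1) cube_nonempty by (auto simp: level_def)
    then have "R' \<notin> G D S J x" using no R'(2) R(2) by auto
    then have "1 / x \<le> J R'" using R' R by (auto simp: G_def level_def not_less)
    then show ?case using R' R(2) by auto
  qed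
  then obtain R where "R \<in> level D S (n + m)" "1 / x \<le> J R" by blast
  then show False using m[of "n + m" R] by simp
qed

text \<open>
  Distinct cubes of one level are disjoint, so the nonempty cubes of \<open>G x\<close> found below them are
  distinct as well.
\<close>

lemma N_le_M:
  assumes "x > 0" "1 / x \<le> 2 powr (- \<alpha> * real n)"
  shows "N D S J \<alpha> n \<le> M D S J x"
proof -
  let ?A = "{Q \<in> level D S n. J Q \<ge> 2 powr (- \<alpha> * real n)}"
  have "\<forall>Q\<in>?A. \<exists>R\<in>G D S J x. R \<subseteq> Q \<and> R \<noteq> {}"
    using G_below_large_cube[OF assms(1)] assms(2) by auto
  then obtain g where g: "\<And>Q. Q \<in> ?A \<Longrightarrow> g Q \<in> G D S J x \<and> g Q \<subseteq> Q \<and> g Q \<noteq> {}" by metis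
  have "inj_on g ?A"
  proof (rule inj_onI)
    fix Q R assume QR: "Q \<in> ?A" "R \<in> ?A" "g Q = g R"
    then obtain z where "z \<in> Q" "z \<in> R" using g[of Q] g[of R] by auto
    then show "Q = R" using cube_eqI[of Q n R z] QR by (auto simp: level_def)
  qed
  moreover have "g ` ?A \<subseteq> G D S J x" using g by blast
  ultimately show ?thesis
    unfolding N_def M_def using finite_G[OF assms(1)] by (rule card_inj_on_le)
qed

lemma h_lower_nonneg: "0 \<le> h_lower D S J"
proof -
  obtain Q where "Q \<in> S" "J Q \<noteq> 0" using nontrivial by auto
  then obtain n where Q: "Q \<in> level D S n" "J Q > 0"
    using subset nonneg[of Q] by (fastforce simp: level_def)
  have "\<forall>\<^sub>F x in at_top. 0 \<le> elog (real (M D S J x)) / ereal (ln x)"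
    using eventually_gt_at_top[of 1] eventually_ge_at_top[of "1 / J Q"]
  proof eventually_elim
    case (elim x)
    have "1 / x \<le> J Q" using elim Q(2) by (simp add: field_simps)
    then have "G D S J x \<noteq> {}" using G_below_large_cube[of x Q n] elim(1) Q(1) by auto
    then have "M D S J x \<noteq> 0" using finite_G[of x] elim(1) by (simp add: M_def)
    then have "\<not> real (M D S J x) < x powr 0" using elim(1) by simp
    then have "\<not> elog (real (M D S J x)) / ereal (ln x) < ereal 0"
      by (simp only: elog_ratio_less_iff[OF elim(1)] not_False_eq_True)
    then show ?case by (simp only: zero_ereal_def not_less)
  qed
  then show ?thesis unfolding h_lower_def by (rule Liminf_bounded)
qed

text \<open>
  For given \<open>x\<close>, the level is the last \<open>n\<close> with \<open>2 powr (\<alpha> n) \<le> x\<close>. Then \<open>x\<close> lies below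
  \<open>2 powr (\<alpha> (n + 1))\<close>, and the shift by one is absorbed by the gap between \<open>c \<alpha>\<close> and \<open>c'\<close>.
\<close>

lemma F_lower_le_h_lower: "F_lower D S J \<le> h_lower D S J"
  unfolding F_lower_def
proof (rule SUP_least)
  fix \<alpha> :: real assume "\<alpha> \<in> {0<..}"
  then have \<alpha>: "\<alpha> > 0" by simp
  then show "F_lower_at D S J \<alpha> / ereal \<alpha> \<le> h_lower D S J"
  proof (rule ereal_divide_leI[OF _ h_lower_nonneg])
    fix c :: real assume c: "c > 0" "ereal (c * \<alpha>) < F_lower_at D S J \<alpha>"
    then obtain c' where c': "ereal (c * \<alpha>) < ereal c'" "ereal c' < F_lower_at D S J \<alpha>"
      using ereal_dense2 by blast
    have "c * \<alpha> < c'" using c'(1) by simp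
    moreover have "0 < c * \<alpha>" using c(1) \<alpha> by simp
    ultimately have "c' \<ge> 0" by linarith
    have "\<forall>\<^sub>F n in sequentially. c * \<alpha> * (real n + 1) \<le> c' * real n"
      using \<open>c * \<alpha> < c'\<close> by real_asymp
    with eventually_N_greater[OF c'(2) \<open>c' \<ge> 0\<close>]
    have ev: "\<forall>\<^sub>F n in sequentially. 2 powr (c * \<alpha> * (real n + 1)) \<le> real (N D S J \<alpha> n)"
    proof eventually_elim
      case (elim n)
      have "2 powr (c * \<alpha> * (real n + 1)) \<le> 2 powr (c' * real n)"
        using elim(2) by (intro powr_mono) auto
      then show ?case using elim(1) by linarith
    qed
    have "filterlim (\<lambda>x. log 2 x / \<alpha>) at_top at_top" using \<alpha> by real_asymp
    then have "filterlim (\<lambda>x. nat \<lfloor>log 2 x / \<alpha>\<rfloor>) sequentially at_top"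
      by (intro filterlim_compose[OF filterlim_nat_sequentially]
          filterlim_compose[OF filterlim_floor_sequentially])
    from filterlim_iff[THEN iffD1, OF this, rule_format, OF ev] eventually_gt_at_top[of 1]
    have "\<forall>\<^sub>F x in at_top. ereal c \<le> elog (real (M D S J x)) / ereal (ln x)"
    proof eventually_elim
      case (elim x)
      define n where "n = nat \<lfloor>log 2 x / \<alpha>\<rfloor>"
      have "log 2 x / \<alpha> \<ge> 0" using elim(2) \<alpha> by simp
      then have n: "real n \<le> log 2 x / \<alpha>" "log 2 x / \<alpha> < real n + 1"
        unfolding n_def by linarith+
      then have n': "\<alpha> * real n \<le> log 2 x" "log 2 x \<le> \<alpha> * (real n + 1)"
        using \<alpha> by (auto simp: field_simps)
      have x: "x = 2 powr log 2 x" using elim(2) by simp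
      have "1 / x = 2 powr (- log 2 x)" by (subst x) (simp add: powr_minus_divide)
      also have "\<dots> \<le> 2 powr (- \<alpha> * real n)" using n'(1) by (intro powr_mono) auto
      finally have "N D S J \<alpha> n \<le> M D S J x" using elim(2) by (intro N_le_M) auto
      have "x powr c = 2 powr (log 2 x * c)" by (subst x) (simp only: powr_powr)
      also have "\<dots> \<le> 2 powr (c * \<alpha> * (real n + 1))"
        using mult_right_mono[OF n'(2), of c] c(1) by (intro powr_mono) (auto simp: algebra_simps)
      also have "\<dots> \<le> real (N D S J \<alpha> n)" using elim(1) by (simp add: n_def)
      also have "\<dots> \<le> real (M D S J x)" using \<open>N D S J \<alpha> n \<le> M D S J x\<close> by simp
      finally show ?case using elog_ratio_less_iff[OF elim(2)] by (meson not_less)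
    qed
    then show "ereal c \<le> h_lower D S J" unfolding h_lower_def by (rule Liminf_bounded)
  qed
qed

lemma h_lower_le_upper: "h_lower D S J \<le> h_upper D S J"
  unfolding h_lower_def h_upper_def by (rule Liminf_le_Limsup) simp

theorem MF_regular_consequences:
  assumes "MF_regular D S J"
  shows "h_lower D S J = h_upper D S J" "h_upper D S J = \<qq> D S J" "\<qq> D S J = \<kappa> S J" "\<kappa> S J = F_upper D S J"
proof -
  have eq: "F_lower D S J = F_upper D S J" using assms by (simp add: MF_regular_def)
  note chain = F_lower_le_h_lower h_lower_le_upper h_upper_le_\<qq> \<qq>_le_F_upper[folded eq]
  show "h_lower D S J = h_upper D S J" using chain by (meson antisym order_trans)
  show "h_upper D S J = \<qq> D S J" using chain by (meson antisym order_trans)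
  show "\<qq> D S J = \<kappa> S J" by (rule \<qq>_eq_\<kappa>)
  then show "\<kappa> S J = F_upper D S J" using \<qq>_le_F_upper F_upper_le_\<qq> by (metis antisym)
qed

section \<open>Regularity of the partition function\<close>

text \<open>
  The middle cubes, those with value between \<open>2 powr (- \<beta> n)\<close> and \<open>2 powr (- \<gamma> n)\<close>, are
  counted by \<open>N\<close>. The contribution of the smaller and of the larger ones is controlled by
  shifting the exponent \<open>q\<close> down and up.
\<close>

lemma power_sum_le_split:
  assumes "t \<ge> 0" "q \<ge> 0"
  shows "power_sum n q \<le> 2 powr (- (\<gamma> * q * real n)) * real (N D S J \<beta> n)
    + 2 powr (- (\<beta> * t * real n)) * power_sum n (q - t)
    + 2 powr (\<gamma> * t * real n) * power_sum n (q + t)"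
proof -
  define mid where "mid = (\<lambda>Q. if 2 powr (- \<beta> * real n) \<le> J Q then 2 powr (- (\<gamma> * q * real n)) else 0)"
  have "J Q powr q \<le> mid Q + 2 powr (- (\<beta> * t * real n)) * J Q powr (q - t)
      + 2 powr (\<gamma> * t * real n) * J Q powr (q + t)" (is "_ \<le> _ + ?l + ?u")
    if Q: "Q \<in> level D S n" for Q
  proof -
    have nn: "0 \<le> mid Q" "0 \<le> ?l" "0 \<le> ?u" by (auto simp: mid_def)
    consider "J Q < 2 powr (- \<beta> * real n)" | "2 powr (- \<gamma> * real n) < J Q"
      | "2 powr (- \<beta> * real n) \<le> J Q" "J Q \<le> 2 powr (- \<gamma> * real n)" by linarith
    then show ?thesis
    proof cases
      case 1
      have "J Q powr q = J Q powr t * J Q powr (q - t)" by (simp add: powr_add[symmetric])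
      also have "\<dots> \<le> (2 powr (- \<beta> * real n)) powr t * J Q powr (q - t)"
        using 1 assms(1) level_nonneg[OF Q] by (intro mult_right_mono powr_mono2) auto
      also have "\<dots> = ?l" by (simp add: powr_powr algebra_simps)
      finally show ?thesis using nn by linarith
    next
      case 2
      have "1 = 2 powr (\<gamma> * t * real n) * (2 powr (- \<gamma> * real n)) powr t"
        by (simp add: powr_powr powr_add[symmetric] algebra_simps)
      also have "\<dots> \<le> 2 powr (\<gamma> * t * real n) * J Q powr t"
        using 2 assms(1) by (intro mult_left_mono powr_mono2) auto
      finally have "1 * J Q powr q \<le> 2 powr (\<gamma> * t * real n) * J Q powr t * J Q powr q"
        by (intro mult_right_mono) auto
      also have "\<dots> = ?u" by (simp add: powr_add)
      finally show ?thesis using nn by linarith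
    next
      case 3
      have "J Q powr q \<le> (2 powr (- \<gamma> * real n)) powr q"
        using 3 assms(2) level_nonneg[OF Q] by (intro powr_mono2) auto
      also have "\<dots> = mid Q" using 3(1) by (simp add: mid_def powr_powr algebra_simps)
      finally show ?thesis using nn by linarith
    qed
  qed
  then have "power_sum n q \<le> (\<Sum>Q\<in>level D S n. mid Q + 2 powr (- (\<beta> * t * real n)) * J Q powr (q - t)
      + 2 powr (\<gamma> * t * real n) * J Q powr (q + t))"
    by (rule sum_mono)
  also have "\<dots> = (\<Sum>Q\<in>level D S n. mid Q) + 2 powr (- (\<beta> * t * real n)) * power_sum n (q - t)
      + 2 powr (\<gamma> * t * real n) * power_sum n (q + t)"
    by (simp only: sum.distrib sum_distrib_left)
  also have "(\<Sum>Q\<in>level D S n. mid Q) = 2 powr (- (\<gamma> * q * real n)) * real (N D S J \<beta> n)"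
    by (simp add: mid_def sum.If_cases finite_level N_def Int_def)
  finally show ?thesis .
qed

text \<open>
  If \<open>\<tau>_upper\<close> grows to the left of \<open>q\<close> with slope less than \<open>\<beta>\<close> and drops to the right with
  slope more than \<open>\<gamma>\<close>, then the outer cubes are exponentially negligible.
\<close>

lemma F_lower_at_ge_concentration:
  assumes "t \<ge> 0" "q \<ge> 0" "ereal c < \<tau>_lower D S J q"
    and left: "\<tau>_upper D S J (q - t) < ereal (c + \<beta> * t)"
    and right: "\<tau>_upper D S J (q + t) < ereal (c - \<gamma> * t)"
  shows "ereal (\<gamma> * q + c) \<le> F_lower_at D S J \<beta>"
proof -
  obtain u where u: "\<tau>_upper D S J (q - t) < ereal u" "ereal u < ereal (c + \<beta> * t)"
    using ereal_dense2[OF left] by blast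
  obtain v where v: "\<tau>_upper D S J (q + t) < ereal v" "ereal v < ereal (c - \<gamma> * t)"
    using ereal_dense2[OF right] by blast
  have absorb: "2 powr s * X \<le> 2 powr (c * real n) / 4"
    if "X < 2 powr (w * real n)" "4 \<le> 2 powr (e * real n)" "s + w * real n + e * real n = c * real n"
    for s w X e and n :: nat
  proof -
    have "2 powr s * X \<le> 2 powr s * 2 powr (w * real n)"
      using that(1) by (intro mult_left_mono) auto
    then have "2 powr s * X * 4 \<le> 2 powr s * 2 powr (w * real n) * 2 powr (e * real n)"
      using that(2) by (rule mult_mono) auto
    also have "\<dots> = 2 powr (c * real n)"
      using that(3) by (simp add: powr_add[symmetric])
    finally show ?thesis by simp
  qed
  have "c + \<beta> * t - u > 0" "c - \<gamma> * t - v > 0" using u v by auto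
  note ev = this[THEN eventually_const_le_powr[of _ 4]]
  have "\<forall>\<^sub>F n in sequentially. 2 powr ((\<gamma> * q + c) * real n) \<le> 2 * real (N D S J \<beta> n)"
    using eventually_power_sum_greater[OF assms(3)] eventually_power_sum_less[OF u(1)]
      eventually_power_sum_less[OF v(1)] ev
  proof eventually_elim
    case (elim n)
    have "2 powr (- (\<beta> * t * real n)) * power_sum n (q - t) \<le> 2 powr (c * real n) / 4"
      by (rule absorb[OF elim(2,4)]) (simp add: algebra_simps)
    moreover have "2 powr (\<gamma> * t * real n) * power_sum n (q + t) \<le> 2 powr (c * real n) / 4"
      by (rule absorb[OF elim(3,5)]) (simp add: algebra_simps)
    ultimately have "2 powr (c * real n) / 2 \<le> 2 powr (- (\<gamma> * q * real n)) * real (N D S J \<beta> n)"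
      using power_sum_le_split[OF assms(1,2), of n \<gamma> \<beta>] elim(1) by linarith
    then have "2 powr (\<gamma> * q * real n) * 2 powr (c * real n)
        \<le> 2 * (2 powr (\<gamma> * q * real n) * 2 powr (- (\<gamma> * q * real n)) * real (N D S J \<beta> n))"
      by (simp add: field_simps)
    then show ?case by (simp add: powr_add[symmetric] algebra_simps)
  qed
  then show ?thesis by (rule F_lower_at_geI)
qed

text \<open>
  Let \<open>\<sigma> = (y - v) / t\<close> be the rate at which \<open>\<tau>_upper\<close> drops to the right of \<open>q\<close>; the rate on
  the left exceeds it by at most \<open>\<eta>\<close>. Concentration with \<open>\<beta> = \<sigma> + 2 \<eta>\<close> and \<open>\<gamma> = \<sigma> - \<eta>\<close> gives
  \<open>F_lower \<ge> q \<gamma> / \<beta>\<close>, and \<open>\<gamma> / \<beta> = 1 - 3 \<eta> / \<beta> \<ge> 1 - 3 \<eta> / \<delta>\<close>. Secants instead of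
  derivatives make this usable on an interval as well as at a point of differentiability.
\<close>

lemma F_lower_ge_almost_linear:
  assumes "t > 0" "\<eta> > 0" "\<delta> > 0" "q \<ge> 0"
    and y: "\<tau>_lower D S J q = ereal y" "y \<ge> 0"
    and u: "\<tau>_upper D S J (q - t) \<le> ereal u" and v: "\<tau>_upper D S J (q + t) \<le> ereal v"
    and second_difference: "u - y \<le> (y - v) + \<eta> * t" and slope: "\<delta> * t \<le> y - v"
  shows "ereal (q * (1 - 3 * \<eta> / \<delta>)) \<le> F_lower D S J"
proof -
  define \<sigma> where "\<sigma> = (y - v) / t"
  have \<sigma>t: "\<sigma> * t = y - v" using assms(1) by (simp add: \<sigma>_def)
  have "\<sigma> \<ge> \<delta>" using slope assms(1) by (simp add: \<sigma>_def pos_le_divide_eq)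
  define \<beta> where "\<beta> = \<sigma> + 2 * \<eta>"
  define \<gamma> where "\<gamma> = \<sigma> - \<eta>"
  have "\<beta> > 0" using assms(2,3) \<open>\<sigma> \<ge> \<delta>\<close> by (simp add: \<beta>_def)
  have "\<eta> * t > 0" using assms(1,2) by simp
  have "ereal (\<gamma> * q) \<le> F_lower_at D S J \<beta>"
  proof (rule ereal_le_epsilon2)
    fix e :: real assume "e > 0"
    \<comment> \<open>The concentration estimate needs strict inequalities, so \<open>\<beta>\<close> has a reserve of \<open>\<eta>\<close> beyond
      the permitted second difference and \<open>\<gamma>\<close> one of \<open>\<eta>\<close> below the slope.\<close>
    define c where "c = y - min e (\<eta> * t) / 2"
    have c: "c < y" "y - e \<le> c" "y - \<eta> * t < c"
      using \<open>e > 0\<close> \<open>\<eta> * t > 0\<close> by (auto simp: c_def min_def)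
    have \<beta>t: "\<beta> * t = y - v + 2 * (\<eta> * t)" and \<gamma>t: "\<gamma> * t = y - v - \<eta> * t"
      using \<sigma>t by (auto simp: \<beta>_def \<gamma>_def algebra_simps)
    have "u < c + \<beta> * t" using second_difference c(3) unfolding \<beta>t by linarith
    then have l: "\<tau>_upper D S J (q - t) < ereal (c + \<beta> * t)" using u by (simp add: order_le_less_trans)
    have "v < c - \<gamma> * t" using c(3) unfolding \<gamma>t by linarith
    then have r: "\<tau>_upper D S J (q + t) < ereal (c - \<gamma> * t)" using v by (simp add: order_le_less_trans)
    have "ereal (\<gamma> * q + c) \<le> F_lower_at D S J \<beta>"
      using assms(1,4) c(1) y(1) l r by (intro F_lower_at_ge_concentration) auto
    moreover have "\<gamma> * q - e \<le> \<gamma> * q + c" using c(2) y(2) by linarith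
    ultimately have "ereal (\<gamma> * q - e) \<le> F_lower_at D S J \<beta>"
      by (rule ereal_le_le)
    then have "ereal (\<gamma> * q - e) + ereal e \<le> F_lower_at D S J \<beta> + ereal e"
      by (rule add_right_mono)
    then show "ereal (\<gamma> * q) \<le> F_lower_at D S J \<beta> + ereal e" by simp
  qed
  moreover have "q * (1 - 3 * \<eta> / \<delta>) * \<beta> \<le> \<gamma> * q"
  proof -
    have "\<eta> * \<delta> \<le> \<eta> * \<beta>" using assms(2) \<open>\<sigma> \<ge> \<delta>\<close> by (simp add: \<beta>_def)
    then have "\<eta> \<le> \<eta> * \<beta> / \<delta>" using assms(3) by (simp add: pos_le_divide_eq)
    then have "(1 - 3 * \<eta> / \<delta>) * \<beta> \<le> \<gamma>"
      by (simp add: \<beta>_def \<gamma>_def left_diff_distrib)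
    then have "q * ((1 - 3 * \<eta> / \<delta>) * \<beta>) \<le> q * \<gamma>"
      by (rule mult_left_mono[OF _ assms(4)])
    then show ?thesis by (simp only: mult.assoc mult.commute[of \<gamma> q])
  qed
  ultimately have "ereal (q * (1 - 3 * \<eta> / \<delta>) * \<beta>) \<le> F_lower_at D S J \<beta>"
    by (rule ereal_le_le)
  then show ?thesis by (rule F_lower_ge[OF \<open>\<beta> > 0\<close>])
qed

text \<open>
  Cubes of value at least \<open>2 powr (- A n)\<close> gain at most \<open>2 powr (A (q - p) n)\<close> when the exponent
  is lowered from \<open>q\<close> to \<open>p\<close>. For \<open>A = d / a\<close> all other cubes together contribute at most \<open>1\<close>,
  which does not matter as long as \<open>y \<ge> 0\<close>.
\<close>

lemma \<tau>_upper_Lipschitz: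
  assumes "0 < a" "a \<le> p" "p \<le> q" "\<tau>_upper D S J q \<le> ereal y" "y \<ge> 0"
  shows "\<tau>_upper D S J p \<le> ereal (y + real CARD('d) / a * (q - p))"
proof (rule ereal_le_epsilon2)
  fix e :: real assume "e > 0"
  define A where "A = real CARD('d) / a"
  have A: "A \<ge> 0" "real CARD('d) \<le> A * p"
    using assms(1) mult_left_mono[OF assms(2), of "real CARD('d) / a"] by (auto simp: A_def)
  define s where "s = y + A * (q - p) + e"
  have "s \<ge> 0" using assms(3,5) A(1) \<open>e > 0\<close> by (simp add: s_def)
  have "\<tau>_upper D S J q < ereal (y + e)" using assms(4) \<open>e > 0\<close> by (simp add: order_le_less_trans)
  from eventually_power_sum_less[OF this]
  have "\<forall>\<^sub>F n in sequentially. power_sum n p \<le> 2 * 2 powr (s * real n)"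
  proof eventually_elim
    case (elim n)
    have "J Q powr p \<le> 2 powr (A * (q - p) * real n) * J Q powr q + 2 powr (- real CARD('d) * real n)"
      if Q: "Q \<in> level D S n" for Q
    proof (cases "2 powr (- A * real n) \<le> J Q")
      case True
      have "1 = 2 powr (A * (q - p) * real n) * (2 powr (- A * real n)) powr (q - p)"
        by (simp add: powr_powr powr_add[symmetric] algebra_simps)
      also have "\<dots> \<le> 2 powr (A * (q - p) * real n) * J Q powr (q - p)"
        using True assms(3) by (intro mult_left_mono powr_mono2) auto
      finally have "1 * J Q powr p \<le> 2 powr (A * (q - p) * real n) * J Q powr (q - p) * J Q powr p"
        by (intro mult_right_mono) auto
      also have "\<dots> = 2 powr (A * (q - p) * real n) * J Q powr q"
        by (simp add: powr_add[symmetric] mult.assoc)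
      finally show ?thesis by (simp add: add_increasing2)
    next
      case False
      have "J Q powr p \<le> (2 powr (- A * real n)) powr p"
        using False assms(1,2) level_nonneg[OF Q] by (intro powr_mono2) auto
      also have "\<dots> = 2 powr (- (A * p) * real n)" by (simp add: powr_powr algebra_simps)
      also have "\<dots> \<le> 2 powr (- real CARD('d) * real n)"
        using A(2) by (intro powr_mono mult_right_mono) auto
      finally show ?thesis by (simp add: add_increasing)
    qed
    then have "power_sum n p
        \<le> (\<Sum>Q\<in>level D S n. 2 powr (A * (q - p) * real n) * J Q powr q + 2 powr (- real CARD('d) * real n))"
      by (rule sum_mono)
    also have "\<dots> = 2 powr (A * (q - p) * real n) * power_sum n q
        + real (card (level D S n)) * 2 powr (- real CARD('d) * real n)"
      by (simp add: sum.distrib sum_distrib_left)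
    also have "2 powr (A * (q - p) * real n) * power_sum n q
        \<le> 2 powr (A * (q - p) * real n) * 2 powr ((y + e) * real n)"
      using elim by (intro mult_left_mono) auto
    also have "\<dots> = 2 powr (s * real n)" by (simp add: s_def powr_add[symmetric] algebra_simps)
    also have "real (card (level D S n)) * 2 powr (- real CARD('d) * real n)
        \<le> 2 powr (real CARD('d) * real n) * 2 powr (- real CARD('d) * real n)"
      using card_level_S by (intro mult_right_mono) auto
    also have "\<dots> = 1" by (simp add: powr_add[symmetric])
    also have "1 \<le> 2 powr (s * real n)" using \<open>s \<ge> 0\<close> by (intro ge_one_powr_ge_zero) auto
    finally show ?case by simp
  qed
  then have "\<tau>_upper D S J p \<le> ereal s" by (rule \<tau>_upper_le_constI)
  then show "\<tau>_upper D S J p \<le> ereal (y + real CARD('d) / a * (q - p)) + ereal e"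
    by (simp add: s_def A_def)
qed

text \<open>
  If the gap \<open>g i - g (i + 1)\<close> dropped by more than \<open>e\<close> in each of the first \<open>k\<close> steps, it would
  end up negative.
\<close>

lemma exists_small_second_difference:
  fixes g :: "nat \<Rightarrow> real"
  assumes "g (Suc k) \<le> g k" "g 0 - g 1 < real k * e"
  shows "\<exists>i<k. g i - g (Suc i) \<le> g (Suc i) - g (Suc (Suc i)) + e"
proof (rule ccontr)
  assume "\<not> ?thesis"
  then have step: "g (Suc i) - g (Suc (Suc i)) < g i - g (Suc i) - e" if "i < k" for i
    using that by force
  have "g i - g (Suc i) \<le> g 0 - g 1 - real i * e" if "i \<le> k" for i
    using that
  proof (induction i)
    case 0
    then show ?case by simp
  next
    case (Suc i)
    then show ?case using step[of i] by (simp add: algebra_simps)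
  qed
  from this[of k] show False using assms by simp
qed

text \<open>
  For \<open>z < \<qq>\<close>, an interval \<open>{a..b}\<close> between \<open>z\<close> and \<open>\<qq>\<close> is divided into \<open>k + 1\<close> steps of length
  \<open>t\<close>. By the Lipschitz bound the first gap of \<open>\<tau>_upper\<close> is at most \<open>A t\<close>, and a large \<open>k\<close>
  provides a grid point at which the second difference is at most \<open>\<eta> t\<close>. The bound obtained
  there is at least \<open>a (1 - 3 \<eta> / \<delta>)\<close>, and \<open>\<eta>\<close> is chosen to make this equal to \<open>z\<close>.
\<close>

lemma \<qq>_le_F_lower_if_limit_below:
  assumes "\<epsilon> > 0"
    and lim: "\<And>q. q \<ge> 0 \<Longrightarrow> \<qq> D S J - ereal \<epsilon> < ereal q \<Longrightarrow> ereal q < \<qq> D S J \<Longrightarrow>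
      \<tau>_upper D S J q = \<tau>_lower D S J q"
  shows "\<qq> D S J \<le> F_lower D S J"
proof -
  obtain r where r: "\<qq> D S J = ereal r" "r \<ge> 0"
    using \<qq>_nonneg \<qq>_finite by (cases "\<qq> D S J") auto
  obtain \<delta> where \<delta>: "\<delta> > 0"
    "\<And>q q' c. q \<le> q' \<Longrightarrow> \<tau>_upper D S J q \<le> ereal c \<Longrightarrow> \<tau>_upper D S J q' \<le> ereal (c - \<delta> * (q' - q))"
    using \<tau>_upper_decay by blast
  have below: "ereal z \<le> F_lower D S J" if z: "0 < z" "r - \<epsilon> < z" "z < r" for z
  proof -
    obtain a where a: "z < a" "a < r" using dense[OF z(3)] by blast
    obtain b where b: "a < b" "b < r" using dense[OF a(2)] by blast
    have "a > 0" using z(1) a(1) by linarith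
    define \<theta> where "\<theta> = 1 - z / a"
    have \<theta>: "\<theta> > 0" "\<theta> < 1" "a * (1 - \<theta>) = z" using z(1) a(1) by (auto simp: \<theta>_def)
    define \<eta> where "\<eta> = \<theta> * \<delta> / 3"
    have \<eta>: "\<eta> > 0" "1 - 3 * \<eta> / \<delta> = 1 - \<theta>" using \<theta>(1) \<delta>(1) by (auto simp: \<eta>_def)
    define A where "A = real CARD('d) / a"
    obtain k where k: "A / \<eta> < real k" using reals_Archimedean2 by blast
    then have kA: "A < real k * \<eta>" using \<eta>(1) by (simp add: pos_divide_less_eq)
    define t where "t = (b - a) / real (Suc k)"
    have t: "t > 0" using b(1) by (simp add: t_def)
    define p where "p i = a + real i * t" for i
    have p_range: "a \<le> p i" "p i \<le> b" if "i \<le> Suc k" for i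
    proof -
      show "a \<le> p i" using t by (simp add: p_def)
      have "real i * t \<le> real (Suc k) * t" using that t by (intro mult_right_mono) auto
      also have "\<dots> = b - a" by (simp add: t_def del: of_nat_Suc)
      finally show "p i \<le> b" by (simp add: p_def)
    qed
    have p_Suc: "p (Suc i) = p i + t" for i by (simp add: p_def algebra_simps)
    have "\<forall>i. \<exists>y. i \<le> Suc k \<longrightarrow> y > 0 \<and> \<tau>_upper D S J (p i) = ereal y"
    proof (intro allI)
      fix i
      show "\<exists>y. i \<le> Suc k \<longrightarrow> y > 0 \<and> \<tau>_upper D S J (p i) = ereal y"
      proof (cases "i \<le> Suc k")
        case True
        have "0 \<le> p i" "ereal (p i) < \<qq> D S J" using p_range[OF True] \<open>a > 0\<close> b(2) r(1) by auto
        then show ?thesis by (rule \<tau>_upper_pos_below_\<qq>) auto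
      qed simp
    qed
    then obtain g where g: "\<And>i. i \<le> Suc k \<Longrightarrow> g i > 0" "\<And>i. i \<le> Suc k \<Longrightarrow> \<tau>_upper D S J (p i) = ereal (g i)"
      by metis
    have g_decay: "\<delta> * t \<le> g i - g (Suc i)" if "i \<le> k" for i
      using \<delta>(2)[of "p i" "p (Suc i)" "g i"] g(2)[of i] g(2)[of "Suc i"] that t by (simp add: p_Suc)
    have "\<delta> * t > 0" using \<delta>(1) t by simp
    have "g 0 - g 1 \<le> A * t"
      using \<tau>_upper_Lipschitz[of a "p 0" "p 1" "g 1"] \<open>a > 0\<close> g(2)[of 0] g(2)[of 1] g(1)[of 1] t p_Suc[of 0]
      by (simp add: p_def A_def)
    also have "\<dots> < real k * \<eta> * t" using kA t by (rule mult_strict_right_mono)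
    finally have "g 0 - g 1 < real k * (\<eta> * t)" by simp
    moreover have "g (Suc k) \<le> g k" using g_decay[of k] \<open>\<delta> * t > 0\<close> by linarith
    ultimately obtain i where i: "i < k" "g i - g (Suc i) \<le> g (Suc i) - g (Suc (Suc i)) + \<eta> * t"
      using exists_small_second_difference by blast
    let ?q = "p (Suc i)"
    have q: "a \<le> ?q" "?q \<le> b" using p_range[of "Suc i"] i(1) by auto
    have "\<tau>_lower D S J ?q = ereal (g (Suc i))"
    proof -
      have "\<qq> D S J - ereal \<epsilon> < ereal ?q" "ereal ?q < \<qq> D S J" "0 \<le> ?q"
        using q a b z r(1) \<open>a > 0\<close> by auto
      then show ?thesis using lim g(2)[of "Suc i"] i(1) by simp
    qed
    then have "ereal (?q * (1 - 3 * \<eta> / \<delta>)) \<le> F_lower D S J"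
      using t \<eta>(1) \<delta>(1) q(1) \<open>a > 0\<close> g(1)[of "Suc i"] g(2)[of i] g(2)[of "Suc (Suc i)"] i g_decay[of "Suc i"]
      by (intro F_lower_ge_almost_linear[where t = t and u = "g i" and v = "g (Suc (Suc i))" and y = "g (Suc i)"])
        (auto simp: p_Suc)
    moreover have "z \<le> ?q * (1 - 3 * \<eta> / \<delta>)"
      unfolding \<eta>(2) \<theta>(3)[symmetric] using q(1) \<theta>(2) by (intro mult_right_mono) auto
    ultimately show ?thesis by (rule ereal_le_le)
  qed
  show ?thesis
  proof (cases "r = 0")
    case True
    then show ?thesis using r(1) F_lower_nonneg by (simp add: zero_ereal_def)
  next
    case False
    show ?thesis
    proof (rule ccontr)
      assume "\<not> ?thesis"
      then have "F_lower D S J < ereal r" using r(1) by simp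
      then have "max (F_lower D S J) (ereal (max 0 (r - \<epsilon>))) < ereal r"
        using False r(2) assms(1) by simp
      then obtain z where "max (F_lower D S J) (ereal (max 0 (r - \<epsilon>))) < ereal z" "ereal z < ereal r"
        using ereal_dense2 by blast
      then have "F_lower D S J < ereal z" "0 < z" "r - \<epsilon> < z" "z < r" by auto
      then show False using below[of z] leD by blast
    qed
  qed
qed

text \<open>
  Differentiability at \<open>\<qq>\<close> makes the two secant slopes for a small step \<open>t\<close> differ by at most
  \<open>\<eta>\<close>, and the value at \<open>\<qq>\<close> is nonnegative as a limit of values from the left.
\<close>

lemma \<qq>_le_F_lower_if_differentiable:
  assumes r: "\<qq> D S J = ereal r" and lim: "\<tau>_upper D S J r = \<tau>_lower D S J r"
    and "\<epsilon> > 0" and f: "\<And>q. q \<in> {0..} \<inter> ball r \<epsilon> \<Longrightarrow> \<tau>_upper D S J q = ereal (f q)"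
    and diff: "f differentiable (at r within {0..})"
  shows "\<qq> D S J \<le> F_lower D S J"
proof (cases "r = 0")
  case True
  then show ?thesis using r F_lower_nonneg by (simp add: zero_ereal_def)
next
  case False
  moreover have "r \<ge> 0" using \<qq>_nonneg r by simp
  ultimately have "r > 0" by simp
  obtain \<delta> where \<delta>: "\<delta> > 0"
    "\<And>q q' c. q \<le> q' \<Longrightarrow> \<tau>_upper D S J q \<le> ereal c \<Longrightarrow> \<tau>_upper D S J q' \<le> ereal (c - \<delta> * (q' - q))"
    using \<tau>_upper_decay by blast
  have "at r within {0..} = at r" using \<open>r > 0\<close> by (intro at_within_interior) simp
  then obtain d where d: "(f has_real_derivative d) (at r)"
    using diff by (auto simp: real_differentiable_def)
  have fr: "\<tau>_upper D S J r = ereal (f r)" using f[of r] \<open>r > 0\<close> \<open>\<epsilon> > 0\<close> by simp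
  have left_nonneg: "f q \<ge> 0" if "0 \<le> q" "q < r" "r - \<epsilon> < q" for q
    using \<tau>_upper_nonneg_below_\<qq>[of q] that r f[of q] by (simp add: dist_real_def)
  have "f r \<ge> 0"
  proof (rule tendsto_lowerbound)
    show "(f \<longlongrightarrow> f r) (at_left r)"
      using DERIV_isCont[OF d] by (auto simp: isCont_def intro: tendsto_within_subset)
    have "max 0 (r - \<epsilon>) < r" using \<open>r > 0\<close> \<open>\<epsilon> > 0\<close> by simp
    then show "\<forall>\<^sub>F q in at_left r. 0 \<le> f q"
      by (rule eventually_mono[OF eventually_at_leftI[of "max 0 (r - \<epsilon>)", rotated]]) (use left_nonneg in auto)
  qed simp
  have approx: "ereal (r * (1 - 3 * \<eta> / \<delta>)) \<le> F_lower D S J" if \<eta>: "\<eta> > 0" for \<eta>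
  proof -
    have "(\<lambda>h. (f (r + h) - f r) / h) \<midarrow>0\<rightarrow> d" using d by (simp add: DERIV_def)
    from LIM_D[OF this, of "\<eta> / 2"] obtain s where s: "s > 0"
      "\<And>h. h \<noteq> 0 \<Longrightarrow> \<bar>h\<bar> < s \<Longrightarrow> \<bar>(f (r + h) - f r) / h - d\<bar> < \<eta> / 2"
      using \<eta> by auto
    define t where "t = min (s / 2) (min (r / 2) (\<epsilon> / 2))"
    have t: "t > 0" "t < s" "t < r" "t < \<epsilon>"
      using s(1) \<open>r > 0\<close> \<open>\<epsilon> > 0\<close> by (auto simp: t_def min_def)
    have "\<bar>(f (r + t) - f r) / t - d\<bar> < \<eta> / 2" "\<bar>(f (r - t) - f r) / (- t) - d\<bar> < \<eta> / 2"
      using s(2)[of t] s(2)[of "- t"] t by auto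
    moreover have "(f (r - t) - f r) / t = - ((f (r - t) - f r) / (- t))"
      "(f r - f (r + t)) / t = - ((f (r + t) - f r) / t)"
      by (simp_all add: minus_divide_left)
    ultimately have "(f (r - t) - f r) / t < (f r - f (r + t)) / t + \<eta>"
      by linarith
    then have "(f (r - t) - f r) / t * t < ((f r - f (r + t)) / t + \<eta>) * t"
      using t(1) by (rule mult_strict_right_mono)
    then have second: "f (r - t) - f r \<le> (f r - f (r + t)) + \<eta> * t"
      using t(1) by (simp add: distrib_right)
    have fl: "\<tau>_upper D S J (r - t) = ereal (f (r - t))" and fu: "\<tau>_upper D S J (r + t) = ereal (f (r + t))"
      using f[of "r - t"] f[of "r + t"] t \<open>r > 0\<close> by (auto simp: dist_real_def)
    have "\<delta> * t \<le> f r - f (r + t)"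
      using \<delta>(2)[of r "r + t" "f r"] t(1) fr fu by simp
    then show ?thesis
      using t(1) \<eta> \<delta>(1) \<open>r > 0\<close> fr lim fl fu \<open>f r \<ge> 0\<close> second
      by (intro F_lower_ge_almost_linear[where t = t and u = "f (r - t)" and v = "f (r + t)" and y = "f r"]) auto
  qed
  show ?thesis
  proof (rule ereal_le_epsilon2)
    fix e :: real assume "e > 0"
    define \<eta> where "\<eta> = e * \<delta> / (3 * r)"
    have "\<eta> > 0" "r * (1 - 3 * \<eta> / \<delta>) = r - e"
      using \<open>e > 0\<close> \<delta>(1) \<open>r > 0\<close> by (auto simp: \<eta>_def field_simps)
    then have "ereal (r - e) \<le> F_lower D S J" using approx by metis
    then have "ereal (r - e) + ereal e \<le> F_lower D S J + ereal e" by (rule add_right_mono)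
    then show "\<qq> D S J \<le> F_lower D S J + ereal e" using r by simp
  qed
qed

theorem PF_regular_imp_MF_regular:
  assumes "PF_regular D S J"
  shows "MF_regular D S J"
proof -
  have "\<qq> D S J \<le> F_lower D S J"
    using assms unfolding PF_regular_def
  proof (elim disjE exE conjE)
    fix \<epsilon> :: real
    assume "\<epsilon> > 0" "\<forall>q\<ge>0. \<qq> D S J - ereal \<epsilon> < ereal q \<and> ereal q < \<qq> D S J \<longrightarrow> \<tau>_upper D S J q = \<tau>_lower D S J q"
    then show ?thesis by (intro \<qq>_le_F_lower_if_limit_below[of \<epsilon>]) auto
  next
    fix r f and \<epsilon> :: real
    assume "\<qq> D S J = ereal r" "\<tau>_upper D S J r = \<tau>_lower D S J r" "\<epsilon> > 0"
      "\<forall>q\<in>{0..} \<inter> ball r \<epsilon>. \<tau>_upper D S J q = ereal (f q)" "f differentiable (at r within {0..})"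
    then show ?thesis by (intro \<qq>_le_F_lower_if_differentiable[of r \<epsilon> f]) auto
  qed
  then show ?thesis
    unfolding MF_regular_def using F_upper_le_\<qq> F_lower_le_upper by (meson antisym order_trans)
qed

end

theorem theorem1p12:
  fixes Q0 :: "(real ^ 'd) set" and D :: "nat \<Rightarrow> (real ^ 'd) set set"
    and S :: "(real ^ 'd) set set" and J :: "(real ^ 'd) set \<Rightarrow> real"
  assumes "partition_set_function Q0 D S J"
    and "dim_infty D S J > 0"
  shows "(PF_regular D S J \<longrightarrow> MF_regular D S J) \<and>
    (MF_regular D S J \<longrightarrow>
       h_lower D S J = h_upper D S J \<and>
       h_upper D S J = \<qq> D S J \<and>
       \<qq> D S J = \<kappa> S J \<and>
       \<kappa> S J = F_upper D S J)"
proof -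
  interpret decaying_set_function Q0 D S J
    using assms by (intro decaying_set_function.intro decaying_set_function_axioms.intro)
  show ?thesis
    using PF_regular_imp_MF_regular MF_regular_consequences by blast
qed

end
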